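(* Let $(\Omega,\mathcal G,\mathbb P)$ be a probability space, $\mathcal F=(\mathcal F_t)_{t\in[0,\infty)}$ a filtration with $\mathcal F_\infty\subset\mathcal G$, and $X$ an $\mathbb R^d$-valued Lévy process relative to $\mathcal F$ with law $\mathcal L$ on $(\mathbb D,\mathcal D)$. For $x\in\mathbb R^d$ let $\mathbb P^x$ be the law of $x+X$ under $\mathbb P$, $\mathcal P:=(\mathbb P^x)_{x\in\mathbb R^d}$. Let $R:\Omega\to[0,\infty]$ be $\mathcal G$-measurable with $\mathbb P(R<\infty)>0$ and $\mathbb P'(\cdot):=\mathbb P(\cdot\mid R<\infty)$. Consider: (i) under $\mathbb P'$, conditionally on $X_R$, $\theta_RX$ is independent of $\mathcal F_R'$ and has kernel law $\mathcal P$, i.e. $\mathbb E_{\mathbb P'}[H(\theta_RX)W]=\mathbb E_{\mathbb P'}[\mathbb P^{X_R}(H)W]$ for all $\mathcal D$-measurable $H:\mathbb D\to[0,\infty]$ and all $\mathcal F_R'$-measurable $W:\{R<\infty\}\to[0,\infty]$; (ii) $\Delta_RX$ is independent of $\mathcal F_R'$ under $\mathbb P'$ and the law of $\Delta_RX$ under $\mathbb P'$ is $\mathcal L$; (iii) $R$ is a stopping time relative to the completion of $\mathcal F$. Then (iii) implies (ii), and (i) and (ii) are equivalent. If in addition $R$ is $\overline{\sigma(X)}$-measurable, then (ii) implies (iii).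
   Context: $X$ is a Lévy process relative to $\mathcal F$: $\mathcal F$-adapted, càdlàg, $X_0=0$ a.s., and $X_t-X_s$ independent of $\mathcal F_s$ with the law of $X_{t-s}$ for $s\le t$. $(\mathbb D,\mathcal D)$: càdlàg paths $[0,\infty)\to\mathbb R^d$ with the coordinate $\sigma$-field. On $\{R<\infty\}$, $\theta_RX:=(X_{R+t})_{t\ge0}$ and $\Delta_RX:=(X_{R+t}-X_R)_{t\ge0}$. $\mathcal F_R'$ is the $\sigma$-field on $\{R<\infty\}$ generated by $Z_R$ as $Z$ ranges over real processes measurable w.r.t. the optional $\sigma$-field of $\mathcal F$ (generated by $\mathcal F$-adapted càdlàg real processes). $\overline{\mathcal H}$ denotes the $\sigma$-field generated by $\mathcal H$ and the $\mathbb P$-null sets of $\mathcal G$; the completion of a filtration is obtained by completing each member. *)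

theory Defs
  imports "HOL-Probability.Probability"
begin

definition filtration_on :: "'a measure \<Rightarrow> (real \<Rightarrow> 'a set set) \<Rightarrow> bool" where
  "filtration_on M F \<longleftrightarrow>
     (\<forall>t\<ge>0. sigma_algebra (space M) (F t) \<and> F t \<subseteq> sets M) \<and>
     (\<forall>s t. 0 \<le> s \<longrightarrow> s \<le> t \<longrightarrow> F s \<subseteq> F t)"

definition cadlag :: "(real \<Rightarrow> 'b::topological_space) \<Rightarrow> bool" where
  "cadlag f \<longleftrightarrow> (\<forall>t\<ge>0. continuous (at_right t) f) \<and> (\<forall>t>0. \<exists>l. (f \<longlongrightarrow> l) (at_left t))"

definition adapted :: "'a measure \<Rightarrow> (real \<Rightarrow> 'a set set) \<Rightarrow> (real \<Rightarrow> 'a \<Rightarrow> 'b::topological_space) \<Rightarrow> bool" where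
  "adapted M F Y \<longleftrightarrow> (\<forall>t\<ge>0. Y t \<in> borel_measurable (sigma (space M) (F t)))"

definition gen_sets :: "'a set \<Rightarrow> 'b measure \<Rightarrow> ('a \<Rightarrow> 'b) \<Rightarrow> 'a set set" where
  "gen_sets \<Omega> N f = {f -` A \<inter> \<Omega> | A. A \<in> sets N}"

definition levy_process_wrt ::
  "'a measure \<Rightarrow> (real \<Rightarrow> 'a set set) \<Rightarrow> (real \<Rightarrow> 'a \<Rightarrow> 'd::euclidean_space) \<Rightarrow> bool" where
  "levy_process_wrt M F X \<longleftrightarrow>
     adapted M F X \<and>
     (\<forall>\<omega>\<in>space M. cadlag (\<lambda>t. X t \<omega>)) \<and>
     (AE \<omega> in M. X 0 \<omega> = 0) \<and>
     (\<forall>s t. 0 \<le> s \<longrightarrow> s \<le> t \<longrightarrow>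
        prob_space.indep_set M (F s) (gen_sets (space M) borel (\<lambda>\<omega>. X t \<omega> - X s \<omega>)) \<and>
        distr M borel (\<lambda>\<omega>. X t \<omega> - X s \<omega>) = distr M borel (X (t - s)))"

text \<open>Cadlag paths [0,\<infinity>) \<rightarrow> 'd, represented as functions on real, normalised to 0 on (-\<infinity>,0).\<close>
definition D_space :: "(real \<Rightarrow> 'd::euclidean_space) set" where
  "D_space = {f. cadlag f \<and> (\<forall>t<0. f t = 0)}"

definition D_measure :: "(real \<Rightarrow> 'd::euclidean_space) measure" where
  "D_measure = sigma D_space {{f \<in> D_space. f t \<in> A} | t A. 0 \<le> t \<and> A \<in> sets borel}"

definition path_of :: "(real \<Rightarrow> 'a \<Rightarrow> 'd::euclidean_space) \<Rightarrow> 'a \<Rightarrow> real \<Rightarrow> 'd" where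
  "path_of X \<omega> = (\<lambda>t. if 0 \<le> t then X t \<omega> else 0)"

definition levy_law :: "'a measure \<Rightarrow> (real \<Rightarrow> 'a \<Rightarrow> 'd::euclidean_space) \<Rightarrow> (real \<Rightarrow> 'd) measure" where
  "levy_law M X = distr M D_measure (path_of X)"

definition law_from :: "'a measure \<Rightarrow> (real \<Rightarrow> 'a \<Rightarrow> 'd::euclidean_space) \<Rightarrow> 'd \<Rightarrow> (real \<Rightarrow> 'd) measure" where
  "law_from M X x = distr M D_measure (\<lambda>\<omega>. path_of (\<lambda>t \<omega>'. x + X t \<omega>') \<omega>)"

definition finite_part :: "'a measure \<Rightarrow> ('a \<Rightarrow> ennreal) \<Rightarrow> 'a set" where
  "finite_part M R = {\<omega> \<in> space M. R \<omega> < \<infinity>}"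

text \<open>P' = P( . | R < \<infinity>), realised as a probability measure on the event {R < \<infinity>}.\<close>
definition cond_fin :: "'a measure \<Rightarrow> ('a \<Rightarrow> ennreal) \<Rightarrow> 'a measure" where
  "cond_fin M R = uniform_measure (restrict_space M (finite_part M R)) (finite_part M R)"

text \<open>Shifted process \<theta>_R X and increment process \<Delta>_R X (meaningful on {R<\<infinity>}).\<close>
definition shift_at :: "(real \<Rightarrow> 'a \<Rightarrow> 'd::euclidean_space) \<Rightarrow> ('a \<Rightarrow> ennreal) \<Rightarrow> 'a \<Rightarrow> real \<Rightarrow> 'd" where
  "shift_at X R \<omega> = (\<lambda>t. if 0 \<le> t then X (enn2real (R \<omega>) + t) \<omega> else 0)"

definition incr_at :: "(real \<Rightarrow> 'a \<Rightarrow> 'd::euclidean_space) \<Rightarrow> ('a \<Rightarrow> ennreal) \<Rightarrow> 'a \<Rightarrow> real \<Rightarrow> 'd" where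
  "incr_at X R \<omega> = (\<lambda>t. if 0 \<le> t then X (enn2real (R \<omega>) + t) \<omega> - X (enn2real (R \<omega>)) \<omega> else 0)"

definition value_at :: "(real \<Rightarrow> 'a \<Rightarrow> 'd::euclidean_space) \<Rightarrow> ('a \<Rightarrow> ennreal) \<Rightarrow> 'a \<Rightarrow> 'd" where
  "value_at X R \<omega> = X (enn2real (R \<omega>)) \<omega>"

definition optional_measure :: "'a measure \<Rightarrow> (real \<Rightarrow> 'a set set) \<Rightarrow> (real \<times> 'a) measure" where
  "optional_measure M F = sigma ({0..} \<times> space M)
     (\<Union>Y \<in> {Y :: real \<Rightarrow> 'a \<Rightarrow> real. adapted M F Y \<and> (\<forall>\<omega>\<in>space M. cadlag (\<lambda>t. Y t \<omega>))}.
        gen_sets ({0..} \<times> space M) borel (\<lambda>(t, \<omega>). Y t \<omega>))"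

definition FR_measure :: "'a measure \<Rightarrow> (real \<Rightarrow> 'a set set) \<Rightarrow> ('a \<Rightarrow> ennreal) \<Rightarrow> 'a measure" where
  "FR_measure M F R = sigma (finite_part M R)
     (\<Union>Z \<in> (borel_measurable (optional_measure M F) :: (real \<times> 'a \<Rightarrow> real) set).
        gen_sets (finite_part M R) borel (\<lambda>\<omega>. Z (enn2real (R \<omega>), \<omega>)))"

definition completed_sets :: "'a measure \<Rightarrow> 'a set set \<Rightarrow> 'a set set" where
  "completed_sets M H = sigma_sets (space M) (H \<union> null_sets M)"

definition natural_sets :: "'a measure \<Rightarrow> (real \<Rightarrow> 'a \<Rightarrow> 'd::euclidean_space) \<Rightarrow> 'a set set" where
  "natural_sets M X = sigma_sets (space M) (\<Union>t\<in>{0..}. gen_sets (space M) borel (X t))"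

definition cond_strong_markov ::
  "'a measure \<Rightarrow> (real \<Rightarrow> 'a set set) \<Rightarrow> (real \<Rightarrow> 'a \<Rightarrow> 'd::euclidean_space) \<Rightarrow> ('a \<Rightarrow> ennreal) \<Rightarrow> bool" where
  "cond_strong_markov M F X R \<longleftrightarrow>
     (\<forall>H \<in> (borel_measurable D_measure :: ((real \<Rightarrow> 'd) \<Rightarrow> ennreal) set).
      \<forall>W \<in> (borel_measurable (FR_measure M F R) :: ('a \<Rightarrow> ennreal) set).
        (\<integral>\<^sup>+ \<omega>. H (shift_at X R \<omega>) * W \<omega> \<partial>cond_fin M R)
        = (\<integral>\<^sup>+ \<omega>. (\<integral>\<^sup>+ y. H y \<partial>law_from M X (value_at X R \<omega>)) * W \<omega> \<partial>cond_fin M R))"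

definition cond_indep_incr ::
  "'a measure \<Rightarrow> (real \<Rightarrow> 'a set set) \<Rightarrow> (real \<Rightarrow> 'a \<Rightarrow> 'd::euclidean_space) \<Rightarrow> ('a \<Rightarrow> ennreal) \<Rightarrow> bool" where
  "cond_indep_incr M F X R \<longleftrightarrow>
     prob_space.indep_set (cond_fin M R) (sets (FR_measure M F R))
        (gen_sets (finite_part M R) D_measure (incr_at X R)) \<and>
     distr (cond_fin M R) D_measure (incr_at X R) = levy_law M X"

definition cond_stopping_compl ::
  "'a measure \<Rightarrow> (real \<Rightarrow> 'a set set) \<Rightarrow> ('a \<Rightarrow> ennreal) \<Rightarrow> bool" where
  "cond_stopping_compl M F R \<longleftrightarrow>
     (\<forall>t\<ge>0. {\<omega> \<in> space M. R \<omega> \<le> ennreal t} \<in> completed_sets M (F t))"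

end

theory Submission
  imports Defs
begin

text \<open>
  A stopping time \<open>R\<close> is approximated from above by dyadic times \<open>R\<^sub>n\<close>; the increments after each
  \<open>R\<^sub>n\<close> have law \<open>L\<close> and are independent of the past by the simple Markov property, and right
  continuity passes this on to \<open>R\<close>. It suffices that \<open>A \<inter> {R < q}\<close> lies in the completion
  of \<open>F q\<close> for every \<open>A\<close> in the \<sigma>-field of the past of \<open>R\<close>.

  For the converse, fix \<open>t\<close> and write \<open>{R \<le> t} = {X \<in> B}\<close> almost surely. Let \<open>g\<close> be the
  conditional probability of \<open>X \<in> B\<close> given \<open>F t\<close>, obtained by replacing the increments of \<open>X\<close>
  after \<open>t\<close> by an independent copy. On \<open>{R \<le> t}\<close> the path so obtained is \<open>X\<close> stopped at \<open>R\<close>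
  followed by the increments of \<open>X\<close> between \<open>R\<close> and \<open>t\<close> and then by the fresh copy; these two
  pieces together again form a path of law \<open>L\<close> independent of the past of \<open>R\<close>, just as the
  original increments do. Hence the integral of \<open>g\<close> over \<open>{R \<le> t}\<close> is \<open>P(R \<le> t)\<close>, which is
  also the integral of \<open>g\<close> over the whole space, and so \<open>g\<close> is the indicator of \<open>{R \<le> t}\<close>.
\<close>

subsection \<open>Cadlag paths\<close>

text \<open>The \<open>+ 1\<close> puts the value strictly above \<open>x\<close>, so that limits
  from the right at \<open>x\<close> apply; moreover, for \<open>0 \<le> x\<close>, the event that
  the value is \<open>(k + 1) / 2 ^ n\<close> is decided by comparing \<open>x\<close> with
  \<open>k / 2 ^ n\<close> and \<open>(k + 1) / 2 ^ n\<close>. Through \<open>nat\<close> the values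
  at level \<open>n\<close> are indexed by natural numbers, which makes countable decompositions
  possible.\<close>

definition dyadic_above :: "nat \<Rightarrow> real \<Rightarrow> real" where
  "dyadic_above n x = real (nat \<lfloor>x * 2 ^ n\<rfloor> + 1) / 2 ^ n"

lemma dyadic_above_tendsto:
  assumes "0 \<le> x"
  shows "filterlim (\<lambda>n. dyadic_above n x) (at_right x) sequentially"
proof -
  have eq: "real (nat \<lfloor>x * 2 ^ n\<rfloor> + 1) = real_of_int \<lfloor>x * 2 ^ n\<rfloor> + 1" for n
    using assms by simp
  have lo: "x < dyadic_above n x" for n
    unfolding dyadic_above_def eq
    by (subst pos_less_divide_eq) (simp, rule real_of_int_floor_add_one_gt)
  have hi: "dyadic_above n x \<le> x + (1/2) ^ n" for n
  proof -
    have "(x + (1/2) ^ n) * 2 ^ n = x * 2 ^ n + 1"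
      by (simp add: distrib_right power_one_over)
    then show ?thesis
      unfolding dyadic_above_def eq by (subst pos_divide_le_eq) simp_all
  qed
  have "(\<lambda>n. (1/2::real) ^ n) \<longlonglongrightarrow> 0"
    by (rule LIMSEQ_power_zero) simp
  then have "(\<lambda>n. x + (1/2) ^ n) \<longlonglongrightarrow> x + 0"
    by (rule tendsto_add[OF tendsto_const])
  then have up: "(\<lambda>n. x + (1/2) ^ n) \<longlonglongrightarrow> x"
    by (simp only: add_0_right)
  have "(\<lambda>n. dyadic_above n x) \<longlonglongrightarrow> x"
    using always_eventually[OF allI[OF less_imp_le[OF lo]]] always_eventually[OF allI[OF hi]]
      tendsto_const up by (rule tendsto_sandwich)
  then show ?thesis
    unfolding filterlim_at using lo
    by (auto simp: order_less_imp_not_eq2[OF lo])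
qed

text \<open>The value at a random time is the limit of the values at its dyadic approximations from
  above, and each of those is patched together from countably many maps \<open>Y t\<close>. The
  measure \<open>N\<close> is arbitrary, so the same lemma serves for the full sigma-field, for path
  space and for traces of a completed \<open>F q\<close>.\<close>

lemma measurable_right_continuous_at_time:
  fixes Y :: "real \<Rightarrow> 'a \<Rightarrow> 'b::euclidean_space"
  assumes Y: "\<And>t. 0 \<le> t \<Longrightarrow> Y t \<in> borel_measurable N"
    and rc: "\<And>\<omega> t. \<omega> \<in> space N \<Longrightarrow> 0 \<le> t \<Longrightarrow> continuous (at_right t) (\<lambda>t. Y t \<omega>)"
    and T[measurable]: "T \<in> borel_measurable N"
    and T0: "\<And>\<omega>. \<omega> \<in> space N \<Longrightarrow> 0 \<le> T \<omega>"
  shows "(\<lambda>\<omega>. Y (T \<omega>) \<omega>) \<in> borel_measurable N"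
proof (rule borel_measurable_LIMSEQ_metric)
  fix n
  show "(\<lambda>\<omega>. Y (dyadic_above n (T \<omega>)) \<omega>) \<in> borel_measurable N"
    unfolding dyadic_above_def
    by (rule measurable_compose_countable[where f="\<lambda>k. Y (real (k + 1) / 2 ^ n)"])
      (auto intro!: Y)
next
  fix \<omega> assume \<omega>: "\<omega> \<in> space N"
  show "(\<lambda>n. Y (dyadic_above n (T \<omega>)) \<omega>) \<longlonglongrightarrow> Y (T \<omega>) \<omega>"
    using rc[OF \<omega> T0[OF \<omega>]] dyadic_above_tendsto[OF T0[OF \<omega>]]
    unfolding continuous_within by (rule filterlim_compose)
qed

section \<open>Closure properties of cadlag functions\<close>

lemma cadlag_right_continuous: "cadlag f \<Longrightarrow> 0 \<le> t \<Longrightarrow> continuous (at_right t) f"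
  by (simp add: cadlag_def)

text \<open>Only right neighbourhoods of points \<open>t \<ge> 0\<close> and left neighbourhoods of
  points \<open>t > 0\<close> enter, and the latter can be taken inside the interval from 0 to
  \<open>t\<close>. This justifies normalising paths to 0 at negative times.\<close>

lemma cadlag_cong:
  assumes "cadlag f" and eq: "\<And>t. 0 \<le> t \<Longrightarrow> f t = g t"
  shows "cadlag g"
  unfolding cadlag_def
proof (intro conjI allI impI)
  fix t :: real assume t: "0 \<le> t"
  have "eventually (\<lambda>u. f u = g u) (at_right t)"
    using eventually_at_right_less[of t] by eventually_elim (use t eq in auto)
  moreover have "(f \<longlongrightarrow> f t) (at_right t)"
    using assms t by (auto simp: cadlag_def continuous_within)
  ultimately show "continuous (at_right t) g"
    using eq[OF t] by (simp add: continuous_within tendsto_cong)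
next
  fix t :: real assume t: "0 < t"
  have "eventually (\<lambda>u. f u = g u) (at_left t)"
    unfolding eventually_at_left_field using t eq by (auto intro!: exI[of _ 0])
  moreover obtain l where "(f \<longlongrightarrow> l) (at_left t)"
    using assms t by (auto simp: cadlag_def)
  ultimately show "\<exists>l. (g \<longlongrightarrow> l) (at_left t)"
    by (auto simp: tendsto_cong)
qed

lemma cadlag_const: "cadlag (\<lambda>t. c)"
  by (auto simp: cadlag_def)

lemma cadlag_add:
  fixes f g :: "real \<Rightarrow> 'b::topological_monoid_add"
  shows "cadlag f \<Longrightarrow> cadlag g \<Longrightarrow> cadlag (\<lambda>t. f t + g t)"
  unfolding cadlag_def continuous_within by (auto intro: tendsto_add) (metis tendsto_add)

lemma cadlag_compose:
  fixes f :: "real \<Rightarrow> 'b::t2_space" and h :: "'b \<Rightarrow> 'c::topological_space"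
  assumes "cadlag f" and h: "continuous_on UNIV h"
  shows "cadlag (\<lambda>t. h (f t))"
proof -
  have "\<And>l. isCont h l" using h by (simp add: continuous_on_eq_continuous_at)
  then show ?thesis
    using assms(1) isCont_tendsto_compose[of _ h f]
    unfolding cadlag_def continuous_within[where f=f] continuous_within[where f="\<lambda>t. h (f t)"]
    by metis
qed

lemma filterlim_diff_at_right: "filterlim (\<lambda>u. u - r) (at_right (t - r)) (at_right (t::real))"
  unfolding filterlim_at
  by (intro conjI tendsto_diff tendsto_const tendsto_ident_at) (simp add: eventually_at_filter)

lemma filterlim_diff_at_left: "filterlim (\<lambda>u. u - r) (at_left (t - r)) (at_left (t::real))"
  unfolding filterlim_at
  by (intro conjI tendsto_diff tendsto_const tendsto_ident_at) (simp add: eventually_at_filter)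

lemma cadlag_shift:
  assumes "cadlag x" "0 \<le> r"
  shows "cadlag (\<lambda>t. x (r + t))"
  unfolding cadlag_def
proof (intro conjI allI impI)
  fix t :: real assume t: "0 \<le> t"
  have "(x \<longlongrightarrow> x (r + t)) (at_right (t + r))"
    using assms t by (auto simp: cadlag_def continuous_within add.commute)
  then show "continuous (at_right t) (\<lambda>t. x (r + t))"
    using filterlim_compose[OF _ filterlim_diff_at_right[of "-r" t], of x "nhds (x (r + t))"]
    by (simp add: continuous_within add.commute)
next
  fix t :: real assume t: "0 < t"
  then obtain l where "(x \<longlongrightarrow> l) (at_left (t + r))"
    using assms by (auto simp: cadlag_def) (meson add_pos_nonneg)
  then show "\<exists>l. ((\<lambda>t. x (r + t)) \<longlongrightarrow> l) (at_left t)"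
    using filterlim_compose[OF _ filterlim_diff_at_left[of "-r" t], of x "nhds l"]
    by (auto simp: add.commute)
qed

text \<open>On either side of each point the stopped path locally agrees with \<open>x\<close> or
  with a constant. At \<open>t = r\<close> the right limit comes from the constant piece and the
  left limit from \<open>x\<close>, hence the two different case splits.\<close>

lemma cadlag_stop:
  assumes "cadlag x" "0 \<le> r"
  shows "cadlag (\<lambda>u. x (min u r))"
  unfolding cadlag_def
proof (intro conjI allI impI)
  fix t :: real assume t: "0 \<le> t"
  show "continuous (at_right t) (\<lambda>u. x (min u r))"
  proof (cases "t < r")
    case True
    have "eventually (\<lambda>u. x u = x (min u r)) (at_right t)"
      unfolding eventually_at_right_field using True by (auto intro!: exI[of _ r])
    moreover have "(x \<longlongrightarrow> x t) (at_right t)"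
      using assms t by (auto simp: cadlag_def continuous_within)
    ultimately show ?thesis using True by (simp add: continuous_within tendsto_cong)
  next
    case False
    have "eventually (\<lambda>u. x (min u r) = x r) (at_right t)"
      using eventually_at_right_less[of t] by eventually_elim (use False in \<open>auto simp: min_def\<close>)
    then show ?thesis using False by (simp add: continuous_within tendsto_eventually min_absorb2)
  qed
next
  fix t :: real assume t: "0 < t"
  show "\<exists>l. ((\<lambda>u. x (min u r)) \<longlongrightarrow> l) (at_left t)"
  proof (cases "t \<le> r")
    case True
    have "eventually (\<lambda>u. x u = x (min u r)) (at_left t)"
      unfolding eventually_at_filter using True by (auto simp: min_def)
    moreover obtain l where "(x \<longlongrightarrow> l) (at_left t)"
      using assms t by (auto simp: cadlag_def)
    ultimately show ?thesis by (auto simp: tendsto_cong)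
  next
    case False
    have "eventually (\<lambda>u. x (min u r) = x r) (at_left t)"
      unfolding eventually_at_left_field using False
      by (auto intro!: exI[of _ r] simp: min_def)
    then show ?thesis by (auto intro: tendsto_eventually)
  qed
qed

text \<open>At the junction \<open>r\<close> the value is already taken from \<open>y\<close>, so
  right continuity holds there even if \<open>y 0\<close> is not 0, while the left limit at
  \<open>r\<close> is 0.\<close>

lemma cadlag_delay:
  fixes y :: "real \<Rightarrow> 'b::{topological_space,zero}"
  assumes "cadlag y" "0 \<le> r"
  shows "cadlag (\<lambda>u. if u < r then 0 else y (u - r))"
  unfolding cadlag_def
proof (intro conjI allI impI)
  fix t :: real assume t: "0 \<le> t"
  show "continuous (at_right t) (\<lambda>u. if u < r then 0 else y (u - r))"
  proof (cases "t < r")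
    case True
    have "eventually (\<lambda>u. (if u < r then 0 else y (u - r)) = 0) (at_right t)"
      unfolding eventually_at_right_field using True by (auto intro!: exI[of _ r])
    then show ?thesis using True by (simp add: continuous_within tendsto_eventually)
  next
    case False
    have "eventually (\<lambda>u. y (u - r) = (if u < r then 0 else y (u - r))) (at_right t)"
      using eventually_at_right_less[of t] by eventually_elim (use False in auto)
    moreover have "(y \<longlongrightarrow> y (t - r)) (at_right (t - r))"
      using assms False by (auto simp: cadlag_def continuous_within)
    then have "((\<lambda>u. y (u - r)) \<longlongrightarrow> y (t - r)) (at_right t)"
      using filterlim_diff_at_right by (rule filterlim_compose)
    ultimately show ?thesis using False by (simp add: continuous_within tendsto_cong)
  qed
next
  fix t :: real assume t: "0 < t"
  show "\<exists>l. ((\<lambda>u. if u < r then 0 else y (u - r)) \<longlongrightarrow> l) (at_left t)"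
  proof (cases "t \<le> r")
    case True
    have "eventually (\<lambda>u. (if u < r then 0 else y (u - r)) = 0) (at_left t)"
      unfolding eventually_at_filter using True by auto
    then show ?thesis by (auto intro: tendsto_eventually)
  next
    case False
    have "eventually (\<lambda>u. y (u - r) = (if u < r then 0 else y (u - r))) (at_left t)"
      unfolding eventually_at_left_field using False by (auto intro!: exI[of _ r])
    moreover obtain l where "(y \<longlongrightarrow> l) (at_left (t - r))"
      using assms False by (auto simp: cadlag_def) (meson not_le diff_gt_0_iff_gt)
    then have "((\<lambda>u. y (u - r)) \<longlongrightarrow> l) (at_left t)"
      using filterlim_diff_at_left by (rule filterlim_compose)
    ultimately show ?thesis by (auto simp: tendsto_cong)
  qed
qed

section \<open>The path space and its coordinate sigma-field\<close>

lemma space_D_measure[simp]: "space D_measure = D_space"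
  unfolding D_measure_def by (rule space_measure_of) auto

lemma sets_D_measure:
  "sets D_measure = sigma_sets D_space {{f \<in> D_space. f t \<in> A} | t A. 0 \<le> t \<and> A \<in> sets borel}"
  unfolding D_measure_def by (rule sets_measure_of) auto

lemma measurable_D_coordinate: "0 \<le> t \<Longrightarrow> (\<lambda>f. f t) \<in> borel_measurable D_measure"
proof (rule measurableI)
  fix A :: "'a set" assume "0 \<le> t" "A \<in> sets borel"
  then have "{f \<in> D_space. f t \<in> A} \<in> sets D_measure"
    unfolding sets_D_measure by (intro sigma_sets.Basic) auto
  then show "(\<lambda>f. f t) -` A \<inter> space D_measure \<in> sets D_measure"
    by (simp add: vimage_def Int_def conj_commute)
qed simp

lemma measurable_D_measureI:
  fixes f :: "'a \<Rightarrow> real \<Rightarrow> 'd::euclidean_space"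
  assumes "\<And>\<omega>. \<omega> \<in> space N \<Longrightarrow> f \<omega> \<in> D_space"
    and "\<And>t. 0 \<le> t \<Longrightarrow> (\<lambda>\<omega>. f \<omega> t) \<in> borel_measurable N"
  shows "f \<in> measurable N D_measure"
  unfolding D_measure_def
proof (rule measurable_measure_of)
  fix S :: "(real \<Rightarrow> 'd) set" assume "S \<in> {{f \<in> D_space. f t \<in> A} | t A. 0 \<le> t \<and> A \<in> sets borel}"
  then obtain t A where S: "S = {f \<in> D_space. f t \<in> A}" "0 \<le> t" "A \<in> sets borel"
    by blast
  have "f -` S \<inter> space N = (\<lambda>\<omega>. f \<omega> t) -` A \<inter> space N"
    using assms(1) by (auto simp: S)
  also have "\<dots> \<in> sets N"
    using assms(2)[OF S(2)] S(3) by (rule measurable_sets)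
  finally show "f -` S \<inter> space N \<in> sets N" .
qed (use assms in auto)

lemma cadlag_D_space: "f \<in> D_space \<Longrightarrow> cadlag f"
  by (simp add: D_space_def)

lemma measurable_D_at_time:
  assumes f: "f \<in> measurable N D_measure" and T: "T \<in> borel_measurable N"
    and T0: "\<And>\<omega>. \<omega> \<in> space N \<Longrightarrow> 0 \<le> T \<omega>"
  shows "(\<lambda>\<omega>. f \<omega> (T \<omega>)) \<in> borel_measurable N"
  using measurable_space[OF f] 
  by (intro measurable_right_continuous_at_time[OF _ _ T T0, where Y="\<lambda>t \<omega>. f \<omega> t"])
     (auto intro!: measurable_compose[OF f measurable_D_coordinate] cadlag_right_continuous
       cadlag_D_space)

section \<open>Closed cylinders, uniqueness of measures and limits of laws\<close>

definition closed_cylinder :: "real set \<Rightarrow> (real \<Rightarrow> 'd::euclidean_space set) \<Rightarrow> (real \<Rightarrow> 'd) set" where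
  "closed_cylinder J K = {f \<in> D_space. \<forall>t\<in>J. f t \<in> K t}"

lemma closed_cylinder_sets:
  assumes "finite J" "J \<subseteq> {0..}" "\<And>t. closed (K t)"
  shows "closed_cylinder J K \<in> sets D_measure"
proof -
  have "{f \<in> space D_measure. \<forall>t\<in>J. f t \<in> K t} \<in> sets D_measure"
  proof (rule sets.sets_Collect_finite_All)
    fix t assume "t \<in> J"
    then have "(\<lambda>f. f t) -` K t \<inter> space D_measure \<in> sets D_measure"
      using assms by (intro measurable_sets[OF measurable_D_coordinate]) auto
    then show "{f \<in> space D_measure. f t \<in> K t} \<in> sets D_measure"
      by (simp add: vimage_def Int_def conj_commute)
  qed (use assms in auto)
  then show ?thesis by (simp add: closed_cylinder_def)
qed

text \<open>Closed cylinders form an intersection-stable generator that contains the whole space.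
  Closed sets are preferred to Borel sets because their indicators are limits of bounded continuous
  functions, which makes the criterion usable for limits of paths.\<close>

lemma D_measure_eqI:
  fixes \<mu> \<nu> :: "(real \<Rightarrow> 'd::euclidean_space) measure"
  assumes "finite_measure \<mu>"
    and \<mu>: "sets \<mu> = sets D_measure" and \<nu>: "sets \<nu> = sets D_measure"
    and eq: "\<And>J K. finite J \<Longrightarrow> J \<subseteq> {0..} \<Longrightarrow> (\<And>t. closed (K t)) \<Longrightarrow>
      emeasure \<mu> (closed_cylinder J K) = emeasure \<nu> (closed_cylinder J K)"
  shows "\<mu> = \<nu>"
proof -
  interpret finite_measure \<mu> by fact
  let ?E = "{closed_cylinder J K | J K. finite J \<and> J \<subseteq> {0..} \<and> (\<forall>t. closed (K t :: 'd set))}"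
  have sub: "?E \<subseteq> Pow D_space"
    by (auto simp: closed_cylinder_def)
  have E_sets: "?E \<subseteq> sets D_measure"
    by (auto intro!: closed_cylinder_sets)
  have D: "sets D_measure = sigma_sets D_space ?E"
  proof (rule antisym)
    interpret S: sigma_algebra D_space "sigma_sets D_space ?E"
      using sub by (rule sigma_algebra_sigma_sets)
    \<comment> \<open>Measurability of the identity expresses the inclusion of the two sigma-fields
      and can be checked coordinate by coordinate, on closed sets.\<close>
    have "id \<in> measurable (sigma D_space ?E) (D_measure :: (real \<Rightarrow> 'd) measure)"
    proof (rule measurable_D_measureI)
      fix t :: real assume "0 \<le> t"
      show "(\<lambda>\<omega>. id \<omega> t) \<in> borel_measurable (sigma D_space ?E)"
        unfolding borel_eq_closed
      proof (rule measurable_measure_of)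
        fix S :: "'d set" assume "S \<in> Collect closed"
        then have "closed S" by simp
        then have "closed_cylinder {t} (\<lambda>_. S) \<in> sigma_sets D_space ?E"
          using \<open>0 \<le> t\<close> by (intro sigma_sets.Basic CollectI exI[of _ "{t}"] exI[of _ "\<lambda>_. S"]) auto
        moreover have "closed_cylinder {t} (\<lambda>_. S) = (\<lambda>\<omega>. id \<omega> t) -` S \<inter> space (sigma D_space ?E)"
          using sub by (auto simp: closed_cylinder_def space_measure_of_conv)
        ultimately show "(\<lambda>\<omega>. id \<omega> t) -` S \<inter> space (sigma D_space ?E) \<in> sets (sigma D_space ?E)"
          using sub by simp
      qed auto
    qed (use sub in \<open>simp add: space_measure_of_conv\<close>)
    then have "A \<in> sigma_sets D_space ?E" if "A \<in> sets D_measure" for A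
      using measurable_sets[of id "sigma D_space ?E" D_measure A] that sets.sets_into_space[OF that] sub
      by (simp add: space_measure_of_conv Int_absorb2)
    then show "sets D_measure \<subseteq> sigma_sets D_space ?E" by blast
    show "sigma_sets D_space ?E \<subseteq> sets D_measure"
      using sets.sigma_sets_subset[OF E_sets] by simp
  qed
  show ?thesis
  proof (rule measure_eqI_generator_eq[OF _ sub, where A="\<lambda>_. D_space"])
    show "Int_stable ?E"
    proof (rule Int_stableI)
      fix a b assume "a \<in> ?E" "b \<in> ?E"
      then obtain J K J' K' where
        a: "a = closed_cylinder J K" "finite J" "J \<subseteq> {0..}" "\<And>t. closed (K t)" and
        b: "b = closed_cylinder J' K'" "finite J'" "J' \<subseteq> {0..}" "\<And>t. closed (K' t)"
        by auto
      \<comment> \<open>Each cylinder imposes \<open>UNIV\<close> at times outside its own index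
        set, so both can be written over the union of the index sets.\<close>
      let ?K = "\<lambda>t. (if t \<in> J then K t else UNIV) \<inter> (if t \<in> J' then K' t else UNIV)"
      have "a \<inter> b = closed_cylinder (J \<union> J') ?K"
        by (auto simp: a(1) b(1) closed_cylinder_def split: if_splits)
      moreover have "closed (?K t)" for t
        using a b by auto
      ultimately show "a \<inter> b \<in> ?E"
        using a b by (intro CollectI exI[of _ "J \<union> J'"] exI[of _ ?K]) auto
    qed
    show "range (\<lambda>_. D_space) \<subseteq> ?E"
      by (auto intro!: exI[of _ "{}"] exI[of _ "\<lambda>_. UNIV"] simp: closed_cylinder_def)
  qed (use D \<mu> \<nu> eq emeasure_finite in auto)
qed

text \<open>A continuous approximation of the indicator of a closed set. Since
  \<open>infdist x {}\<close> is 0, the formula would give 1 for the empty set, which is therefore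
  treated separately.\<close>

definition closed_bump :: "nat \<Rightarrow> 'd::euclidean_space set \<Rightarrow> 'd \<Rightarrow> real" where
  "closed_bump m K x = (if K = {} then 0 else max 0 (1 - real m * infdist x K))"

lemma closed_bump_bounds: "0 \<le> closed_bump m K x" "closed_bump m K x \<le> 1"
  by (auto simp: closed_bump_def infdist_nonneg)

lemma continuous_on_closed_bump: "continuous_on UNIV (closed_bump m K)"
  unfolding closed_bump_def by (cases "K = {}") (auto intro!: continuous_intros)

lemma closed_bump_tendsto:
  assumes "closed K"
  shows "(\<lambda>m. closed_bump m K x) \<longlonglongrightarrow> indicator K x"
proof (cases "x \<in> K")
  case True
  then have "K \<noteq> {}" by auto
  then show ?thesis using True by (simp add: closed_bump_def)
next
  case False
  show ?thesis
  proof (cases "K = {}")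
    case nonempty: False
    then have pos: "0 < infdist x K"
      using assms False infdist_pos_not_in_closed by blast
    have "eventually (\<lambda>m. closed_bump m K x = 0) sequentially"
      using eventually_ge_at_top[of "nat \<lceil>1 / infdist x K\<rceil>"]
    proof eventually_elim
      case (elim m)
      then have "1 / infdist x K \<le> real m" by linarith
      then show ?case using pos by (simp add: closed_bump_def field_simps)
    qed
    then show ?thesis using False by (simp add: tendsto_eventually)
  qed (simp add: closed_bump_def)
qed

text \<open>For fixed \<open>m\<close>, a product of bumps at finitely many times is a bounded
  continuous function of the coordinates, so its integral passes to the limit in \<open>n\<close> by
  dominated convergence. Letting \<open>m\<close> grow then recovers the mass of closed cylinders.
  The measure \<open>Q\<close> is merely finite so that it can be the restriction of a probability
  to an event.\<close>

lemma distr_D_measure_limit: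
  fixes Y :: "'a \<Rightarrow> real \<Rightarrow> 'd::euclidean_space"
  assumes "finite_measure Q"
    and Yn: "\<And>n. Yn n \<in> measurable Q D_measure" and Y: "Y \<in> measurable Q D_measure"
    and lim: "\<And>\<omega> t. \<omega> \<in> space Q \<Longrightarrow> 0 \<le> t \<Longrightarrow> (\<lambda>n. Yn n \<omega> t) \<longlonglongrightarrow> Y \<omega> t"
    and law: "\<And>n. distr Q D_measure (Yn n) = \<nu>"
  shows "distr Q D_measure Y = \<nu>"
proof (rule D_measure_eqI)
  interpret Q: finite_measure Q by fact
  show fY: "finite_measure (distr Q D_measure Y)"
    by (rule Q.finite_measure_distr[OF Y])
  show sets_\<nu>: "sets \<nu> = sets D_measure"
    by (simp flip: law[of 0])
  have fin_\<nu>: "finite_measure \<nu>"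
    unfolding law[of 0, symmetric] by (rule Q.finite_measure_distr[OF Yn])
  fix J :: "real set" and K :: "real \<Rightarrow> 'd set"
  assume J: "finite J" "J \<subseteq> {0..}" and K: "\<And>t. closed (K t)"
  define H where "H m f = (\<Prod>t\<in>J. closed_bump m (K t) (f t))" for m and f :: "real \<Rightarrow> 'd"
  have H_bound: "norm (H m f) \<le> 1" for m f
    by (auto simp: H_def abs_prod closed_bump_bounds intro!: prod_le_1)
  have H_meas: "H m \<in> borel_measurable D_measure" for m
    unfolding H_def using J
    by (intro borel_measurable_prod measurable_compose[OF measurable_D_coordinate]
        borel_measurable_continuous_onI continuous_on_closed_bump) auto
  have H_lim: "(\<lambda>m. H m f) \<longlonglongrightarrow> indicator (closed_cylinder J K) f" if "f \<in> D_space" for f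
  proof -
    have "(\<lambda>m. H m f) \<longlonglongrightarrow> (\<Prod>t\<in>J. indicator (K t) (f t))"
      unfolding H_def by (intro tendsto_prod closed_bump_tendsto K)
    also have "(\<Prod>t\<in>J. indicator (K t) (f t)) = (indicator (closed_cylinder J K) f :: real)"
      using J(1) that by (auto simp: closed_cylinder_def indicator_def prod_zero_iff intro!: prod.neutral)
    finally show ?thesis .
  qed
  \<comment> \<open>The limit in \<open>m\<close>, stated for a general measure because it is used
    for both laws.\<close>
  have to_measure: "(\<lambda>m. \<integral>f. H m f \<partial>\<mu>) \<longlonglongrightarrow> measure \<mu> (closed_cylinder J K)"
    if "finite_measure \<mu>" "sets \<mu> = sets D_measure" for \<mu> :: "(real \<Rightarrow> 'd) measure"
  proof -
    interpret \<mu>: finite_measure \<mu> by fact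
    have sp: "space \<mu> = D_space" using sets_eq_imp_space_eq[OF that(2)] by simp
    have C: "closed_cylinder J K \<in> sets \<mu>" unfolding that(2) by (rule closed_cylinder_sets[OF J K])
    have "(\<lambda>m. \<integral>f. H m f \<partial>\<mu>) \<longlonglongrightarrow> (\<integral>f. indicator (closed_cylinder J K) f \<partial>\<mu>)"
      using H_meas H_lim H_bound sp closed_cylinder_sets[OF J K]
      by (intro integral_dominated_convergence[where w="\<lambda>_. 1"])
        (auto simp: measurable_cong_sets[OF that(2) refl])
    then show ?thesis using C by simp
  qed
  have "(\<integral>f. H m f \<partial>distr Q D_measure Y) = (\<integral>f. H m f \<partial>\<nu>)" for m
  proof (rule LIMSEQ_unique)
    have "(\<lambda>n. \<integral>\<omega>. H m (Yn n \<omega>) \<partial>Q) \<longlonglongrightarrow> (\<integral>\<omega>. H m (Y \<omega>) \<partial>Q)"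
    proof (rule integral_dominated_convergence[where w="\<lambda>_. 1"])
      show "AE \<omega> in Q. (\<lambda>n. H m (Yn n \<omega>)) \<longlonglongrightarrow> H m (Y \<omega>)"
      proof (rule AE_I2)
        fix \<omega> assume "\<omega> \<in> space Q"
        then show "(\<lambda>n. H m (Yn n \<omega>)) \<longlonglongrightarrow> H m (Y \<omega>)"
          unfolding H_def using J lim
          by (intro tendsto_prod continuous_on_tendsto_compose[OF continuous_on_closed_bump]) auto
      qed
    qed (use H_bound in \<open>auto intro: measurable_compose[OF Yn H_meas] measurable_compose[OF Y H_meas]\<close>)
    moreover have "(\<integral>\<omega>. H m (Yn n \<omega>) \<partial>Q) = (\<integral>f. H m f \<partial>\<nu>)" for n
      using integral_distr[OF Yn[of n] H_meas[of m]] by (simp add: law)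
    ultimately show "(\<lambda>n. \<integral>f. H m f \<partial>\<nu>) \<longlonglongrightarrow> (\<integral>f. H m f \<partial>distr Q D_measure Y)"
      by (simp add: integral_distr[OF Y H_meas])
  qed simp
  then have "measure (distr Q D_measure Y) (closed_cylinder J K) = measure \<nu> (closed_cylinder J K)"
    using LIMSEQ_unique[OF to_measure[OF fin_\<nu> sets_\<nu>]] to_measure[OF fY] by simp
  then show "emeasure (distr Q D_measure Y) (closed_cylinder J K) = emeasure \<nu> (closed_cylinder J K)"
    by (simp add: finite_measure.emeasure_eq_measure fY fin_\<nu>)
qed simp

section \<open>Increments, concatenation and translation of paths\<close>

definition path_incr :: "real \<Rightarrow> (real \<Rightarrow> 'd::euclidean_space) \<Rightarrow> real \<Rightarrow> 'd" where
  "path_incr r x = (\<lambda>t. if 0 \<le> t then x (r + t) - x r else 0)"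

definition path_glue :: "real \<Rightarrow> (real \<Rightarrow> 'd::euclidean_space) \<Rightarrow> (real \<Rightarrow> 'd) \<Rightarrow> real \<Rightarrow> 'd" where
  "path_glue r x y = (\<lambda>u. if 0 \<le> u then x (min u r) + (if u < r then 0 else y (u - r)) else 0)"

lemma D_spaceI:
  assumes "cadlag f" "\<And>t. 0 \<le> t \<Longrightarrow> g t = f t" "\<And>t. t < 0 \<Longrightarrow> g t = 0"
  shows "g \<in> D_space"
  using assms cadlag_cong[OF assms(1), of g] by (auto simp: D_space_def)

lemma path_incr_D_space:
  assumes "x \<in> D_space" "0 \<le> r"
  shows "path_incr r x \<in> D_space"
proof (rule D_spaceI)
  show "cadlag (\<lambda>t. x (r + t) + - x r)"
    by (intro cadlag_add cadlag_const cadlag_shift cadlag_D_space assms)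
qed (auto simp: path_incr_def)

lemma path_glue_D_space:
  assumes "x \<in> D_space" "y \<in> D_space" "0 \<le> r"
  shows "path_glue r x y \<in> D_space"
proof (rule D_spaceI)
  show "cadlag (\<lambda>u. x (min u r) + (if u < r then 0 else y (u - r)))"
    by (intro cadlag_add cadlag_stop cadlag_delay cadlag_D_space assms)
qed (auto simp: path_glue_def)

text \<open>Adding the increments after \<open>r\<close> to the path stopped at \<open>r\<close>
  telescopes. The normalisation at negative times in \<open>D_space\<close> turns this into an
  equality of functions on all of the reals.\<close>

lemma path_glue_incr: "x \<in> D_space \<Longrightarrow> 0 \<le> r \<Longrightarrow> path_glue r x (path_incr r x) = x"
  by (auto simp: path_glue_def path_incr_def D_space_def min_def fun_eq_iff)

text \<open>Both sides follow \<open>x\<close> until \<open>r\<close>, then \<open>y\<close> until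
  \<open>t\<close>, then \<open>z\<close>. Read from left to right, replacing the future after the
  fixed time \<open>t\<close> becomes replacing the increments after \<open>r\<close> by another
  concatenation.\<close>

lemma path_glue_assoc:
  "0 \<le> r \<Longrightarrow> r \<le> t \<Longrightarrow> path_glue t (path_glue r x y) z = path_glue r x (path_glue (t - r) y z)"
  by (auto simp: path_glue_def min_def fun_eq_iff)

lemma measurable_path_incr:
  assumes f: "f \<in> measurable N D_measure" and T: "T \<in> borel_measurable N"
    and T0: "\<And>\<omega>. \<omega> \<in> space N \<Longrightarrow> 0 \<le> T \<omega>"
  shows "(\<lambda>\<omega>. path_incr (T \<omega>) (f \<omega>)) \<in> measurable N D_measure"
proof (rule measurable_D_measureI)
  fix t :: real assume t: "0 \<le> t"
  have "(\<lambda>\<omega>. f \<omega> (T \<omega> + t) - f \<omega> (T \<omega>)) \<in> borel_measurable N"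
    using t T0 T by (intro borel_measurable_diff measurable_D_at_time[OF f]) auto
  then show "(\<lambda>\<omega>. path_incr (T \<omega>) (f \<omega>) t) \<in> borel_measurable N"
    using t by (simp add: path_incr_def)
qed (use measurable_space[OF f] T0 in \<open>auto intro!: path_incr_D_space\<close>)

text \<open>Concatenation looks at \<open>f\<close> up to time \<open>T\<close> alone, so
  measurability is asked of the stopped path. Hence \<open>N\<close> may be built on a sigma-field
  of the past, for which the whole path need not be measurable.\<close>

lemma measurable_path_glue:
  assumes f: "\<And>\<omega>. \<omega> \<in> space N \<Longrightarrow> f \<omega> \<in> D_space"
    and f_stop: "\<And>u. 0 \<le> u \<Longrightarrow> (\<lambda>\<omega>. f \<omega> (min u (T \<omega>))) \<in> borel_measurable N"
    and g: "g \<in> measurable N D_measure" and T[measurable]: "T \<in> borel_measurable N"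
    and T0: "\<And>\<omega>. \<omega> \<in> space N \<Longrightarrow> 0 \<le> T \<omega>"
  shows "(\<lambda>\<omega>. path_glue (T \<omega>) (f \<omega>) (g \<omega>)) \<in> measurable N D_measure"
proof (rule measurable_D_measureI)
  fix u :: real assume u: "0 \<le> u"
  \<comment> \<open>The \<open>max 0\<close> keeps the evaluation time nonnegative everywhere; it
    changes nothing on the branch \<open>T \<omega> \<le> u\<close>, where the value is
    used.\<close>
  have [measurable]: "(\<lambda>\<omega>. g \<omega> (max 0 (u - T \<omega>))) \<in> borel_measurable N"
    by (intro measurable_D_at_time[OF g]) auto
  note f_stop[OF u, measurable]
  have "(\<lambda>\<omega>. f \<omega> (min u (T \<omega>)) + (if u < T \<omega> then 0 else g \<omega> (max 0 (u - T \<omega>)))) \<in> borel_measurable N"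
    by measurable
  moreover have "f \<omega> (min u (T \<omega>)) + (if u < T \<omega> then 0 else g \<omega> (max 0 (u - T \<omega>)))
      = path_glue (T \<omega>) (f \<omega>) (g \<omega>) u" for \<omega>
    using u by (simp add: path_glue_def)
  ultimately show "(\<lambda>\<omega>. path_glue (T \<omega>) (f \<omega>) (g \<omega>) u) \<in> borel_measurable N"
    by simp
qed (use measurable_space[OF g] f T0 in \<open>auto intro!: path_glue_D_space\<close>)

lemma measurable_path_glue_D:
  assumes f: "f \<in> measurable N D_measure" and g: "g \<in> measurable N D_measure"
    and T[measurable]: "T \<in> borel_measurable N" and T0: "\<And>\<omega>. \<omega> \<in> space N \<Longrightarrow> 0 \<le> T \<omega>"
  shows "(\<lambda>\<omega>. path_glue (T \<omega>) (f \<omega>) (g \<omega>)) \<in> measurable N D_measure"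
proof (rule measurable_path_glue[OF _ _ g T T0])
  fix u :: real assume "0 \<le> u"
  then show "(\<lambda>\<omega>. f \<omega> (min u (T \<omega>))) \<in> borel_measurable N"
    using T0 by (intro measurable_D_at_time[OF f]) auto
qed (use measurable_space[OF f] in simp)

definition path_translate :: "'d \<Rightarrow> (real \<Rightarrow> 'd::euclidean_space) \<Rightarrow> real \<Rightarrow> 'd" where
  "path_translate x y = (\<lambda>t. if 0 \<le> t then x + y t else 0)"

lemma path_translate_D_space:
  assumes "y \<in> D_space"
  shows "path_translate x y \<in> D_space"
proof (rule D_spaceI)
  show "cadlag (\<lambda>t. x + y t)"
    by (intro cadlag_add cadlag_const cadlag_D_space assms)
qed (auto simp: path_translate_def)

lemma measurable_path_translate:
  assumes f: "f \<in> borel_measurable N" and g: "g \<in> measurable N D_measure"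
  shows "(\<lambda>\<omega>. path_translate (f \<omega>) (g \<omega>)) \<in> measurable N D_measure"
proof (rule measurable_D_measureI)
  fix t :: real assume t: "0 \<le> t"
  show "(\<lambda>\<omega>. path_translate (f \<omega>) (g \<omega>) t) \<in> borel_measurable N"
    using t f measurable_compose[OF g measurable_D_coordinate[OF t]]
    by (simp add: path_translate_def borel_measurable_add)
qed (use measurable_space[OF g] in \<open>auto intro!: path_translate_D_space\<close>)

subsection \<open>Independence and completion\<close>

text \<open>The pair of the outcome and \<open>Y\<close> has a product law, as is checked on
  rectangles; Tonelli then integrates out an independent copy of \<open>Y\<close>. The past is
  encoded by the identity map into a coarser measurable space \<open>N\<close>, so \<open>k\<close>
  may depend on anything that \<open>N\<close> can see.\<close>

lemma nn_integral_independent_pair: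
  assumes M: "finite_measure M" and L: "sigma_finite_measure L"
    and N: "(\<lambda>\<omega>. \<omega>) \<in> measurable M N" and Y: "Y \<in> measurable M S" and LS: "sets L = sets S"
    and eq: "\<And>A C. A \<in> sets N \<Longrightarrow> C \<in> sets S \<Longrightarrow>
      emeasure M (A \<inter> space M \<inter> Y -` C) = emeasure M (A \<inter> space M) * emeasure L C"
    and k: "k \<in> borel_measurable (N \<Otimes>\<^sub>M S)"
  shows "(\<integral>\<^sup>+ \<omega>. k (\<omega>, Y \<omega>) \<partial>M) = (\<integral>\<^sup>+ \<omega>. (\<integral>\<^sup>+ y. k (\<omega>, y) \<partial>L) \<partial>M)"
proof -
  interpret L: sigma_finite_measure L by fact
  have meas: "(\<lambda>\<omega>. \<integral>\<^sup>+ y. k (\<omega>, y) \<partial>L) \<in> borel_measurable N"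
    using k by (intro L.borel_measurable_nn_integral_fst)
      (simp add: measurable_cong_sets[OF sets_pair_measure_cong[OF refl LS] refl])
  let ?N = "distr M N (\<lambda>\<omega>. \<omega>)"
  interpret N: finite_measure ?N
    using M N by (rule finite_measure.finite_measure_distr)
  have pair: "(\<lambda>\<omega>. (\<omega>, Y \<omega>)) \<in> measurable M (N \<Otimes>\<^sub>M S)"
    using N Y by (rule measurable_Pair)
  have sets_eq: "sets (?N \<Otimes>\<^sub>M L) = sets (N \<Otimes>\<^sub>M S)"
    by (rule sets_pair_measure_cong) (auto simp: LS)
  have "?N \<Otimes>\<^sub>M L = distr M (N \<Otimes>\<^sub>M S) (\<lambda>\<omega>. (\<omega>, Y \<omega>))"
  proof (rule pair_measure_eqI)
    fix A C assume A: "A \<in> sets ?N" and C: "C \<in> sets L"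
    have "(\<lambda>\<omega>. (\<omega>, Y \<omega>)) -` (A \<times> C) \<inter> space M = A \<inter> space M \<inter> Y -` C" by auto
    moreover have "A \<times> C \<in> sets (N \<Otimes>\<^sub>M S)" using A C LS by simp
    ultimately show "emeasure ?N A * emeasure L C = emeasure (distr M (N \<Otimes>\<^sub>M S) (\<lambda>\<omega>. (\<omega>, Y \<omega>))) (A \<times> C)"
      using A C LS N pair by (simp add: emeasure_distr eq)
  qed (simp_all only: sets_eq sets_distr N.sigma_finite_measure_axioms L)
  then have "(\<integral>\<^sup>+ \<omega>. k (\<omega>, Y \<omega>) \<partial>M) = (\<integral>\<^sup>+ p. k p \<partial>(?N \<Otimes>\<^sub>M L))"
    using pair k by (simp add: nn_integral_distr)
  also have "\<dots> = (\<integral>\<^sup>+ \<omega>. (\<integral>\<^sup>+ y. k (\<omega>, y) \<partial>L) \<partial>?N)"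
    using k by (subst L.nn_integral_fst[symmetric]) (simp_all add: measurable_cong_sets[OF sets_eq refl])
  also have "\<dots> = (\<integral>\<^sup>+ \<omega>. (\<integral>\<^sup>+ y. k (\<omega>, y) \<partial>L) \<partial>M)"
    using N meas by (simp add: nn_integral_distr)
  finally show ?thesis .
qed

text \<open>The nonnegative function \<open>h - f\<close> has integral 0. Finiteness allows the
  integrals to be subtracted and makes \<open>h\<close> finite almost everywhere, so that a
  vanishing difference yields \<open>h \<le> f\<close>.\<close>

lemma nn_integral_eq_imp_AE_eq:
  fixes f h :: "'a \<Rightarrow> ennreal"
  assumes [measurable]: "f \<in> borel_measurable M" "h \<in> borel_measurable M"
    and le: "\<And>\<omega>. \<omega> \<in> space M \<Longrightarrow> f \<omega> \<le> h \<omega>" and eq: "(\<integral>\<^sup>+ \<omega>. f \<omega> \<partial>M) = (\<integral>\<^sup>+ \<omega>. h \<omega> \<partial>M)"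
    and fin: "(\<integral>\<^sup>+ \<omega>. f \<omega> \<partial>M) \<noteq> \<infinity>"
  shows "AE \<omega> in M. f \<omega> = h \<omega>"
proof -
  have "(\<integral>\<^sup>+ \<omega>. h \<omega> - f \<omega> \<partial>M) = (\<integral>\<^sup>+ \<omega>. h \<omega> \<partial>M) - (\<integral>\<^sup>+ \<omega>. f \<omega> \<partial>M)"
    using fin le by (intro nn_integral_diff) auto
  also have "\<dots> = 0" using eq fin by simp
  finally have "AE \<omega> in M. h \<omega> - f \<omega> = 0"
    by (subst (asm) nn_integral_0_iff_AE) auto
  moreover have "AE \<omega> in M. h \<omega> \<noteq> \<infinity>"
    using fin eq by (intro nn_integral_noteq_infinite) auto
  ultimately show ?thesis
    using AE_space
  proof eventually_elim
    case (elim \<omega>)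
    then have "h \<omega> \<le> f \<omega>" by (auto simp: diff_eq_0_iff_ennreal)
    with le[OF elim(3)] show ?case by (rule antisym)
  qed
qed

lemma measurable_finer:
  "f \<in> measurable A N \<Longrightarrow> space A = space B \<Longrightarrow> sets A \<subseteq> sets B \<Longrightarrow> f \<in> measurable B N"
  unfolding measurable_def by auto

section \<open>Completion of a sigma-field by null sets\<close>

context
  fixes M :: "'a measure" and H :: "'a set set"
  assumes H: "sigma_algebra (space M) H" "H \<subseteq> sets M"
begin

interpretation H: sigma_algebra "space M" H by fact

lemma completed_sets_sigma_algebra: "sigma_algebra (space M) (completed_sets M H)"
  unfolding completed_sets_def
  by (rule sigma_algebra_sigma_sets) (use H.space_closed in \<open>auto dest: sets.sets_into_space\<close>)

lemma completed_sets_superset: "H \<subseteq> completed_sets M H"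
  unfolding completed_sets_def by auto

lemma completed_sets_subset: "completed_sets M H \<subseteq> sets M"
  unfolding completed_sets_def using H by (intro sets.sigma_sets_subset) auto

text \<open>The sets that agree almost everywhere with a member of \<open>H\<close> include
  \<open>H\<close> and the null sets and are closed under complements and countable unions.\<close>

lemma completed_sets_AE_eq:
  assumes "A \<in> completed_sets M H"
  shows "\<exists>B\<in>H. AE \<omega> in M. \<omega> \<in> A \<longleftrightarrow> \<omega> \<in> B"
  using assms unfolding completed_sets_def
proof (induction rule: sigma_sets.induct)
  case (Basic A)
  then consider "A \<in> H" | "A \<in> null_sets M" by blast
  then show ?case
  proof cases
    case 2
    then have "AE \<omega> in M. \<omega> \<notin> A" by (rule AE_not_in)
    then show ?thesis by (intro bexI[of _ "{}"]) auto
  qed auto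
next
  case Empty
  show ?case by (intro bexI[of _ "{}"]) auto
next
  case (Compl A)
  then obtain B where B: "B \<in> H" "AE \<omega> in M. \<omega> \<in> A \<longleftrightarrow> \<omega> \<in> B" by blast
  then have "AE \<omega> in M. \<omega> \<in> space M - A \<longleftrightarrow> \<omega> \<in> space M - B" by auto
  with B(1) show ?case by blast
next
  case (Union A)
  then obtain B where B: "\<And>i::nat. B i \<in> H" "\<And>i. AE \<omega> in M. \<omega> \<in> A i \<longleftrightarrow> \<omega> \<in> B i" by metis
  have "AE \<omega> in M. \<forall>i. \<omega> \<in> A i \<longleftrightarrow> \<omega> \<in> B i" using B(2) by (simp add: AE_all_countable)
  then have "AE \<omega> in M. \<omega> \<in> (\<Union>i. A i) \<longleftrightarrow> \<omega> \<in> (\<Union>i. B i)" by auto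
  then show ?case using B(1) by (intro bexI[of _ "\<Union>i. B i"]) auto
qed

text \<open>\<open>A\<close> arises from \<open>B\<close> by removing and adding a null set, namely
  the two halves of the symmetric difference.\<close>

lemma completed_setsI_AE:
  assumes A: "A \<in> sets M" and B: "B \<in> H" and eq: "AE \<omega> in M. \<omega> \<in> A \<longleftrightarrow> \<omega> \<in> B"
  shows "A \<in> completed_sets M H"
proof -
  interpret C: sigma_algebra "space M" "completed_sets M H" by (rule completed_sets_sigma_algebra)
  have BM: "B \<in> sets M" using B H by auto
  have null: "S \<in> completed_sets M H" if "S \<in> null_sets M" for S
    using that unfolding completed_sets_def by auto
  have "A - B \<in> null_sets M" "B - A \<in> null_sets M"
    using A BM eq by (auto simp: AE_iff_null_sets elim!: AE_mp)
  moreover have "A = (B - (B - A)) \<union> (A - B)" by auto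
  ultimately show ?thesis
    using null B completed_sets_superset by (metis C.Diff C.Un subsetD)
qed

end

subsection \<open>The simple Markov property\<close>

locale levy_process = prob_space M for M :: "'a measure" +
  fixes F :: "real \<Rightarrow> 'a set set" and X :: "real \<Rightarrow> 'a \<Rightarrow> 'd::euclidean_space"
  assumes filtration: "filtration_on M F" and levy: "levy_process_wrt M F X"
begin

text \<open>The sigma-field \<open>F t\<close> as a measure space, so that measurability with
  respect to it can be expressed; integrals are taken with respect to \<open>M\<close>.\<close>

abbreviation Fm :: "real \<Rightarrow> 'a measure" where
  "Fm t \<equiv> sigma (space M) (F t)"

abbreviation path :: "'a \<Rightarrow> real \<Rightarrow> 'd" where
  "path \<equiv> path_of X"

abbreviation L :: "(real \<Rightarrow> 'd) measure" where
  "L \<equiv> levy_law M X"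

lemma F_sigma_algebra: "0 \<le> t \<Longrightarrow> sigma_algebra (space M) (F t)"
  using filtration by (simp add: filtration_on_def)

lemma F_subset: "0 \<le> t \<Longrightarrow> F t \<subseteq> sets M"
  using filtration by (simp add: filtration_on_def)

lemma sets_Fm: "0 \<le> t \<Longrightarrow> sets (Fm t) = F t"
  using F_sigma_algebra by (simp add: sigma_algebra.sets_measure_of_eq)

lemma space_Fm[simp]: "space (Fm t) = space M"
  by (simp add: space_measure_of_conv)

lemma measurable_Fm_M: "0 \<le> t \<Longrightarrow> f \<in> measurable (Fm t) N \<Longrightarrow> f \<in> measurable M N"
  by (erule measurable_finer) (use F_subset in \<open>auto simp: sets_Fm\<close>)

lemma measurable_Fm_mono: "0 \<le> s \<Longrightarrow> s \<le> t \<Longrightarrow> f \<in> measurable (Fm s) N \<Longrightarrow> f \<in> measurable (Fm t) N"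
  by (erule measurable_finer) (use filtration in \<open>auto simp: sets_Fm filtration_on_def\<close>)

lemma X_adapted: "0 \<le> s \<Longrightarrow> s \<le> t \<Longrightarrow> X s \<in> borel_measurable (Fm t)"
  using levy measurable_Fm_mono[of s t "X s"] by (auto simp: levy_process_wrt_def adapted_def)

lemma X_measurable: "0 \<le> t \<Longrightarrow> X t \<in> borel_measurable M"
  using X_adapted measurable_Fm_M by blast

lemma path_D_space: "\<omega> \<in> space M \<Longrightarrow> path \<omega> \<in> D_space"
  using levy by (intro D_spaceI[where f="\<lambda>t. X t \<omega>"]) (auto simp: levy_process_wrt_def path_of_def)

lemma measurable_path: "path \<in> measurable M D_measure"
  by (rule measurable_D_measureI) (simp_all add: path_D_space, simp add: path_of_def X_measurable)

lemma sets_L: "sets L = sets D_measure"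
  by (simp add: levy_law_def)

lemma prob_space_L: "prob_space L"
  unfolding levy_law_def by (rule prob_space_distr[OF measurable_path])

sublocale L: prob_space L by (rule prob_space_L)

lemma nn_integral_L:
  "f \<in> borel_measurable D_measure \<Longrightarrow> (\<integral>\<^sup>+ y. f y \<partial>L) = (\<integral>\<^sup>+ \<omega>. f (path \<omega>) \<partial>M)"
  unfolding levy_law_def by (rule nn_integral_distr) (simp_all add: measurable_path)

text \<open>Here the independence and stationarity in the definition of a Levy process enter;
  everything about later increments is derived from this formula.\<close>

lemma nn_integral_increment:
  assumes s: "0 \<le> s" "s \<le> t" and k: "k \<in> borel_measurable (Fm s \<Otimes>\<^sub>M borel)"
  shows "(\<integral>\<^sup>+ \<omega>. k (\<omega>, X t \<omega> - X s \<omega>) \<partial>M)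
    = (\<integral>\<^sup>+ \<omega>. (\<integral>\<^sup>+ y. k (\<omega>, y) \<partial>distr M borel (X (t - s))) \<partial>M)"
proof (rule nn_integral_independent_pair[OF finite_measure_axioms _ _ _ _ _ k])
  have X_st: "X t \<in> borel_measurable M" "X s \<in> borel_measurable M"
    using s by (auto intro: X_measurable)
  interpret D: prob_space "distr M borel (X (t - s))"
    using s by (intro prob_space_distr X_measurable) auto
  show "sigma_finite_measure (distr M borel (X (t - s)))" ..
  show "(\<lambda>\<omega>. \<omega>) \<in> measurable M (Fm s)"
    using s measurable_Fm_M[of s "\<lambda>\<omega>. \<omega>" "Fm s"] by auto
  show meas: "(\<lambda>\<omega>. X t \<omega> - X s \<omega>) \<in> borel_measurable M"
    using X_st by (rule borel_measurable_diff)
  fix A C assume A: "A \<in> sets (Fm s)" and C: "C \<in> sets (borel :: 'd measure)"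
  let ?B = "(\<lambda>\<omega>. X t \<omega> - X s \<omega>) -` C \<inter> space M"
  have ind: "indep_set (F s) (gen_sets (space M) borel (\<lambda>\<omega>. X t \<omega> - X s \<omega>))"
    and law: "distr M borel (\<lambda>\<omega>. X t \<omega> - X s \<omega>) = distr M borel (X (t - s))"
    using levy s by (auto simp: levy_process_wrt_def)
  have A': "A \<in> F s" "A \<subseteq> space M"
    using A s sets.sets_into_space[OF A] by (auto simp: sets_Fm)
  have "prob (A \<inter> ?B) = prob A * prob ?B"
    using A' C by (intro indep_setD[OF ind]) (auto simp: gen_sets_def)
  moreover have "emeasure (distr M borel (X (t - s))) C = emeasure M ?B"
    using meas C by (simp flip: law add: emeasure_distr)
  moreover have "A \<inter> space M \<inter> (\<lambda>\<omega>. X t \<omega> - X s \<omega>) -` C = A \<inter> ?B" "A \<inter> space M = A"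
    using A' by auto
  ultimately show "emeasure M (A \<inter> space M \<inter> (\<lambda>\<omega>. X t \<omega> - X s \<omega>) -` C)
      = emeasure M (A \<inter> space M) * emeasure (distr M borel (X (t - s))) C"
    by (simp add: emeasure_eq_measure ennreal_mult)
qed simp

text \<open>The transition operator of the increments from time \<open>s\<close> does not depend on \<open>s\<close>; this is what
  identifies the law of the increments after \<open>s\<close> with that of the process itself.\<close>

lemma markov_finite_dim:
  fixes f :: "real \<Rightarrow> 'd \<Rightarrow> ennreal"
  assumes "finite J" and f: "\<And>t. f t \<in> borel_measurable borel"
    and "0 \<le> v" "\<And>t. t \<in> J \<Longrightarrow> v \<le> t"
  shows "\<exists>G\<in>borel_measurable borel. \<forall>s\<ge>0. \<forall>W\<in>borel_measurable (Fm s). \<forall>Z\<in>borel_measurable (Fm s).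
    (\<integral>\<^sup>+ \<omega>. W \<omega> * (\<Prod>t\<in>J. f t (Z \<omega> + (X (s + t - v) \<omega> - X s \<omega>))) \<partial>M) = (\<integral>\<^sup>+ \<omega>. W \<omega> * G (Z \<omega>) \<partial>M)"
  using assms(1,3,4)
proof (induction J arbitrary: v rule: finite_linorder_min_induct)
  case empty
  show ?case by (intro bexI[of _ "\<lambda>_. 1"]) auto
next
  case (insert b A)
  have b: "v \<le> b" "0 \<le> b" using insert.prems(1) insert.prems(2)[of b] by auto
  \<comment> \<open>\<open>v\<close> is the origin from which the times in the index set are
    counted. The least time \<open>b\<close> is split off, and the remaining times are counted from
    \<open>b\<close> instead.\<close>
  from insert.IH[of b] insert.hyps b obtain G where G[measurable]: "G \<in> borel_measurable borel"
    and IH: "\<And>s W Z. 0 \<le> s \<Longrightarrow> W \<in> borel_measurable (Fm s) \<Longrightarrow> Z \<in> borel_measurable (Fm s) \<Longrightarrow>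
      (\<integral>\<^sup>+ \<omega>. W \<omega> * (\<Prod>t\<in>A. f t (Z \<omega> + (X (s + t - b) \<omega> - X s \<omega>))) \<partial>M) = (\<integral>\<^sup>+ \<omega>. W \<omega> * G (Z \<omega>) \<partial>M)"
    by (auto simp: less_imp_le)
  note f[measurable]
  let ?D = "distr M borel (X (b - v))"
  \<comment> \<open>The factor at the first time multiplied by the value of continuing from there.
    Averaging \<open>h\<close> over an increment of length \<open>b - v\<close> gives the new
    transition function.\<close>
  define h where "h z = f b z * G z" for z
  have h[measurable]: "h \<in> borel_measurable borel" unfolding h_def by measurable
  interpret D: prob_space ?D
    using b by (intro prob_space_distr X_measurable) auto
  show ?case
  proof (intro bexI allI impI ballI)
    fix s and W :: "'a \<Rightarrow> ennreal" and Z :: "'a \<Rightarrow> 'd"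
    assume s: "0 \<le> s" and W[measurable]: "W \<in> borel_measurable (Fm s)"
      and Z[measurable]: "Z \<in> borel_measurable (Fm s)"
    \<comment> \<open>The actual time of the first observation. The state reached and the factor
      already collected there, \<open>Z'\<close> and \<open>W'\<close>, are known at
      \<open>r\<close> and serve as input to the induction hypothesis.\<close>
    define r where "r = s + b - v"
    have r: "s \<le> r" "0 \<le> r" using s b by (auto simp: r_def)
    define Z' where "Z' \<omega> = Z \<omega> + (X r \<omega> - X s \<omega>)" for \<omega>
    define W' where "W' \<omega> = W \<omega> * f b (Z' \<omega>)" for \<omega>
    have Z'[measurable]: "Z' \<in> borel_measurable (Fm r)"
      unfolding Z'_def using s r
      by (intro borel_measurable_add borel_measurable_diff X_adapted measurable_Fm_mono[OF _ _ Z]) auto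
    have [measurable]: "W \<in> borel_measurable (Fm r)"
      using s r by (intro measurable_Fm_mono[OF _ _ W]) auto
    have W'[measurable]: "W' \<in> borel_measurable (Fm r)"
      unfolding W'_def by measurable
    have "(\<integral>\<^sup>+ \<omega>. W \<omega> * (\<Prod>t\<in>insert b A. f t (Z \<omega> + (X (s + t - v) \<omega> - X s \<omega>))) \<partial>M)
        = (\<integral>\<^sup>+ \<omega>. W' \<omega> * (\<Prod>t\<in>A. f t (Z' \<omega> + (X (r + t - b) \<omega> - X r \<omega>))) \<partial>M)"
    proof (rule nn_integral_cong)
      fix \<omega>
      have "b \<notin> A" using insert.hyps by auto
      then show "W \<omega> * (\<Prod>t\<in>insert b A. f t (Z \<omega> + (X (s + t - v) \<omega> - X s \<omega>)))
          = W' \<omega> * (\<Prod>t\<in>A. f t (Z' \<omega> + (X (r + t - b) \<omega> - X r \<omega>)))"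
        using insert.hyps by (simp add: W'_def Z'_def r_def algebra_simps)
    qed
    also have "\<dots> = (\<integral>\<^sup>+ \<omega>. W' \<omega> * G (Z' \<omega>) \<partial>M)"
      by (rule IH[OF r(2) W' Z'])
    also have "\<dots> = (\<integral>\<^sup>+ \<omega>. (\<lambda>(\<omega>, y). W \<omega> * h (Z \<omega> + y)) (\<omega>, X r \<omega> - X s \<omega>) \<partial>M)"
      by (simp add: W'_def Z'_def h_def mult.assoc)
    also have "\<dots> = (\<integral>\<^sup>+ \<omega>. (\<integral>\<^sup>+ y. (\<lambda>(\<omega>, y). W \<omega> * h (Z \<omega> + y)) (\<omega>, y) \<partial>distr M borel (X (r - s))) \<partial>M)"
      by (rule nn_integral_increment[OF s r(1)]) measurable
    also have "\<dots> = (\<integral>\<^sup>+ \<omega>. W \<omega> * (\<integral>\<^sup>+ y. h (Z \<omega> + y) \<partial>?D) \<partial>M)"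
    proof -
      have "r - s = b - v" by (simp add: r_def)
      then show ?thesis by (simp add: nn_integral_cmult)
    qed
    finally show "(\<integral>\<^sup>+ \<omega>. W \<omega> * (\<Prod>t\<in>insert b A. f t (Z \<omega> + (X (s + t - v) \<omega> - X s \<omega>))) \<partial>M)
        = (\<integral>\<^sup>+ \<omega>. W \<omega> * (\<integral>\<^sup>+ y. h (Z \<omega> + y) \<partial>?D) \<partial>M)" .
  next
    have "(\<lambda>p. h (fst p + snd p)) \<in> borel_measurable (borel \<Otimes>\<^sub>M (borel :: 'd measure))"
      by measurable
    then show "(\<lambda>z. \<integral>\<^sup>+ y. h (z + y) \<partial>?D) \<in> borel_measurable borel"
      using D.borel_measurable_nn_integral_fst[of "\<lambda>p. h (fst p + snd p)" borel]
      by (simp add: measurable_cong_sets[OF sets_pair_measure_cong[OF refl sets_distr] refl])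
  qed
qed

text \<open>With the weight \<open>indicator A\<close> and the starting point 0,
  \<open>markov_finite_dim\<close> gives a closed cylinder the mass
  \<open>emeasure M A * G 0\<close>. The same \<open>G\<close> at time 0 with weight 1 identifies
  \<open>G 0\<close> as the probability of the cylinder under \<open>L\<close>.\<close>

lemma simple_markov:
  assumes s: "0 \<le> s" and A: "A \<in> F s" and C: "C \<in> sets D_measure"
  shows "emeasure M (A \<inter> {\<omega> \<in> space M. path_incr s (path \<omega>) \<in> C}) = emeasure M A * emeasure L C"
proof -
  have AM: "A \<in> sets M" using F_subset[OF s] A by auto
  have incr: "(\<lambda>\<omega>. path_incr s (path \<omega>)) \<in> measurable M D_measure"
    using s by (intro measurable_path_incr measurable_path) auto
  \<comment> \<open>Two finite measures of total mass \<open>emeasure M A\<close> are compared,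
    rather than conditional laws, so null events are covered.\<close>
  let ?Q = "density M (indicator A)"
  have "distr ?Q D_measure (\<lambda>\<omega>. path_incr s (path \<omega>)) = density L (\<lambda>_. emeasure M A)"
  proof (rule D_measure_eqI)
    show "finite_measure (distr ?Q D_measure (\<lambda>\<omega>. path_incr s (path \<omega>)))"
      using incr AM by (intro finite_measure.finite_measure_distr finite_measure_restricted) auto
    fix J :: "real set" and K :: "real \<Rightarrow> 'd set"
    assume J: "finite J" "J \<subseteq> {0..}" and K: "\<And>t. closed (K t)"
    have C: "closed_cylinder J K \<in> sets D_measure"
      by (rule closed_cylinder_sets[OF J K])
    define f where "f t = (indicator (K t) :: 'd \<Rightarrow> ennreal)" for t
    obtain G where G: "\<And>s W Z. 0 \<le> s \<Longrightarrow> W \<in> borel_measurable (Fm s) \<Longrightarrow> Z \<in> borel_measurable (Fm s) \<Longrightarrow>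
      (\<integral>\<^sup>+ \<omega>. W \<omega> * (\<Prod>t\<in>J. f t (Z \<omega> + (X (s + t - 0) \<omega> - X s \<omega>))) \<partial>M) = (\<integral>\<^sup>+ \<omega>. W \<omega> * G (Z \<omega>) \<partial>M)"
      using markov_finite_dim[of J f 0] J K by (fastforce simp: f_def)
    have prod: "(\<Prod>t\<in>J. f t (y t)) = indicator {y. \<forall>t\<in>J. y t \<in> K t} y" for y
      using J(1) by (auto simp: f_def indicator_def prod_zero_iff intro!: prod.neutral)
    have "emeasure (distr ?Q D_measure (\<lambda>\<omega>. path_incr s (path \<omega>))) (closed_cylinder J K)
        = emeasure M (A \<inter> ((\<lambda>\<omega>. path_incr s (path \<omega>)) -` closed_cylinder J K \<inter> space M))"
      using incr C AM by (simp add: emeasure_distr emeasure_restricted measurable_sets[OF incr])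
    also have "\<dots> = (\<integral>\<^sup>+ \<omega>. indicator A \<omega> * (\<Prod>t\<in>J. f t (0 + (X (s + t - 0) \<omega> - X s \<omega>))) \<partial>M)"
    proof (subst nn_integral_indicator[symmetric])
      show "A \<inter> ((\<lambda>\<omega>. path_incr s (path \<omega>)) -` closed_cylinder J K \<inter> space M) \<in> sets M"
        using AM measurable_sets[OF incr C] by simp
      have "path_incr s (path \<omega>) \<in> closed_cylinder J K
          \<longleftrightarrow> (\<forall>t\<in>J. 0 + (X (s + t - 0) \<omega> - X s \<omega>) \<in> K t)" if "\<omega> \<in> space M" for \<omega>
      proof -
        have "path_incr s (path \<omega>) t = X (s + t) \<omega> - X s \<omega>" if "t \<in> J" for t
          using s J that by (auto simp: path_incr_def path_of_def)
        then show ?thesis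
          using path_incr_D_space[OF path_D_space[OF that] s] by (auto simp: closed_cylinder_def)
      qed
      then show "(\<integral>\<^sup>+ \<omega>. indicator (A \<inter> ((\<lambda>\<omega>. path_incr s (path \<omega>)) -` closed_cylinder J K \<inter> space M)) \<omega> \<partial>M)
          = (\<integral>\<^sup>+ \<omega>. indicator A \<omega> * (\<Prod>t\<in>J. f t (0 + (X (s + t - 0) \<omega> - X s \<omega>))) \<partial>M)"
        unfolding prod by (intro nn_integral_cong) (simp add: indicator_def)
    qed
    also have "\<dots> = emeasure M A * G 0"
    proof -
      have "indicator A \<in> borel_measurable (Fm s)"
        using A s by (intro borel_measurable_indicator) (simp add: sets_Fm)
      then show ?thesis
        using s G[of s "indicator A" "\<lambda>_. 0"] AM by (simp add: nn_integral_multc)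
    qed
    \<comment> \<open>Independence of \<open>G\<close> from \<open>s\<close> is exploited here: at
      \<open>s = 0\<close> the increments are those of the process itself, and almost surely
      \<open>X 0\<close> vanishes.\<close>
    also have "G 0 = (\<integral>\<^sup>+ \<omega>. 1 * (\<Prod>t\<in>J. f t (0 + (X (0 + t - 0) \<omega> - X 0 \<omega>))) \<partial>M)"
      using G[of 0 "\<lambda>_. 1" "\<lambda>_. 0"] by (simp add: emeasure_space_1)
    also have "\<dots> = (\<integral>\<^sup>+ \<omega>. indicator (path -` closed_cylinder J K \<inter> space M) \<omega> \<partial>M)"
    proof (rule nn_integral_cong_AE)
      have "AE \<omega> in M. X 0 \<omega> = 0" using levy by (simp add: levy_process_wrt_def)
      then show "AE \<omega> in M. 1 * (\<Prod>t\<in>J. f t (0 + (X (0 + t - 0) \<omega> - X 0 \<omega>)))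
          = indicator (path -` closed_cylinder J K \<inter> space M) \<omega>"
        using AE_space unfolding prod
      proof eventually_elim
        case (elim \<omega>)
        have "path \<omega> t = X t \<omega>" if "t \<in> J" for t
          using J that by (auto simp: path_of_def)
        then have "path \<omega> \<in> closed_cylinder J K \<longleftrightarrow> (\<forall>t\<in>J. X t \<omega> \<in> K t)"
          using path_D_space[OF elim(2)] by (auto simp: closed_cylinder_def)
        then show ?case using elim by (simp add: indicator_def)
      qed
    qed
    also have "\<dots> = emeasure L (closed_cylinder J K)"
      using C measurable_path measurable_sets[OF measurable_path C] by (simp add: levy_law_def emeasure_distr)
    also have "emeasure M A * \<dots> = emeasure (density L (\<lambda>_. emeasure M A)) (closed_cylinder J K)"
      using C by (simp add: emeasure_density_const sets_L)
    finally show "emeasure (distr ?Q D_measure (\<lambda>\<omega>. path_incr s (path \<omega>))) (closed_cylinder J K)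
        = emeasure (density L (\<lambda>_. emeasure M A)) (closed_cylinder J K)" .
  qed (simp_all add: sets_L)
  then have "emeasure (distr ?Q D_measure (\<lambda>\<omega>. path_incr s (path \<omega>))) C
      = emeasure (density L (\<lambda>_. emeasure M A)) C" by simp
  moreover have "(\<lambda>\<omega>. path_incr s (path \<omega>)) -` C \<inter> space M = {\<omega> \<in> space M. path_incr s (path \<omega>) \<in> C}"
    by auto
  ultimately show ?thesis
    using incr C AM measurable_sets[OF incr C]
    by (simp add: emeasure_distr emeasure_restricted emeasure_density_const sets_L)
qed

text \<open>Replacing \<open>A\<close> by a member of \<open>F s\<close> that agrees with it almost
  everywhere changes neither side.\<close>

lemma simple_markov_completed:
  assumes s: "0 \<le> s" and A: "A \<in> completed_sets M (F s)" and C: "C \<in> sets D_measure"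
  shows "emeasure M (A \<inter> {\<omega> \<in> space M. path_incr s (path \<omega>) \<in> C}) = emeasure M A * emeasure L C"
proof -
  note F = F_sigma_algebra[OF s] F_subset[OF s]
  obtain B where B: "B \<in> F s" "AE \<omega> in M. \<omega> \<in> A \<longleftrightarrow> \<omega> \<in> B"
    using completed_sets_AE_eq[OF F A] by blast
  have AM: "A \<in> sets M" and BM: "B \<in> sets M"
    using completed_sets_subset[OF F] A F B by auto
  have "(\<lambda>\<omega>. path_incr s (path \<omega>)) \<in> measurable M D_measure"
    using s by (intro measurable_path_incr measurable_path) auto
  from measurable_sets[OF this C]
  have S: "{\<omega> \<in> space M. path_incr s (path \<omega>) \<in> C} \<in> sets M"
    by (simp add: vimage_def Int_def conj_commute)
  have "emeasure M (A \<inter> {\<omega> \<in> space M. path_incr s (path \<omega>) \<in> C})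
      = emeasure M (B \<inter> {\<omega> \<in> space M. path_incr s (path \<omega>) \<in> C})"
    using B(2) AM BM S by (intro emeasure_eq_AE) auto
  moreover have "emeasure M A = emeasure M B"
    using B(2) AM BM by (rule emeasure_eq_AE)
  ultimately show ?thesis using simple_markov[OF s B(1) C] by simp
qed

text \<open>The preimages of path-space events under \<open>path\<close> form a sigma-field, and
  each coordinate event is such a preimage.\<close>

lemma natural_sets_path:
  assumes "A \<in> natural_sets M X"
  shows "\<exists>B\<in>sets D_measure. A = path -` B \<inter> space M"
proof -
  let ?V = "vimage_algebra (space M) path D_measure"
  have V: "sets ?V = {path -` B \<inter> space M | B. B \<in> sets D_measure}"
    using measurable_path by (intro sets_vimage_algebra2) (auto dest: measurable_space)
  have "gen_sets (space M) borel (X t) \<subseteq> sets ?V" if t: "0 \<le> t" for t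
  proof
    fix S assume "S \<in> gen_sets (space M) borel (X t)"
    then obtain C where C: "C \<in> sets borel" and S: "S = X t -` C \<inter> space M"
      by (auto simp: gen_sets_def)
    have "(\<lambda>f. f t) -` C \<inter> space D_measure \<in> sets (D_measure :: (real \<Rightarrow> 'd) measure)"
      using measurable_D_coordinate[OF t] C by (rule measurable_sets)
    moreover have "S = path -` ((\<lambda>f. f t) -` C \<inter> space D_measure) \<inter> space M"
      using t path_D_space by (auto simp: S) (auto simp: path_of_def)
    ultimately show "S \<in> sets ?V" unfolding V by blast
  qed
  then have "natural_sets M X \<subseteq> sets ?V"
    unfolding natural_sets_def using sets.sigma_sets_subset[of "\<Union>t\<in>{0..}. gen_sets (space M) borel (X t)" ?V]
    by auto
  then show ?thesis using assms unfolding V by blast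
qed

lemma natural_sets_sigma_algebra: "sigma_algebra (space M) (natural_sets M X)"
  unfolding natural_sets_def by (rule sigma_algebra_sigma_sets) (auto simp: gen_sets_def)

lemma natural_sets_subset: "natural_sets M X \<subseteq> sets M"
  using natural_sets_path measurable_sets[OF measurable_path] by blast

section \<open>Resampling the increments after a fixed time\<close>

lemma nn_integral_Fm_incr:
  assumes s: "0 \<le> s" and k: "k \<in> borel_measurable (Fm s \<Otimes>\<^sub>M D_measure)"
  shows "(\<integral>\<^sup>+ \<omega>. k (\<omega>, path_incr s (path \<omega>)) \<partial>M) = (\<integral>\<^sup>+ \<omega>. (\<integral>\<^sup>+ y. k (\<omega>, y) \<partial>L) \<partial>M)"
proof (rule nn_integral_independent_pair[OF finite_measure_axioms L.sigma_finite_measure_axioms _ _ sets_L _ k])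
  show "(\<lambda>\<omega>. \<omega>) \<in> measurable M (Fm s)"
    using s measurable_Fm_M[of s "\<lambda>\<omega>. \<omega>" "Fm s"] by auto
  show "(\<lambda>\<omega>. path_incr s (path \<omega>)) \<in> measurable M D_measure"
    using s by (intro measurable_path_incr measurable_path) auto
  fix A C assume A: "A \<in> sets (Fm s)" and C: "C \<in> sets (D_measure :: (real \<Rightarrow> 'd) measure)"
  have A': "A \<in> F s" "A \<subseteq> space M"
    using A s sets.sets_into_space[OF A] by (auto simp: sets_Fm)
  have "A \<inter> space M \<inter> (\<lambda>\<omega>. path_incr s (path \<omega>)) -` C
      = A \<inter> {\<omega> \<in> space M. path_incr s (path \<omega>) \<in> C}" "A \<inter> space M = A"
    using A'(2) by auto
  then show "emeasure M (A \<inter> space M \<inter> (\<lambda>\<omega>. path_incr s (path \<omega>)) -` C)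
      = emeasure M (A \<inter> space M) * emeasure L C"
    using simple_markov[OF s A'(1) C] by simp
qed

text \<open>The first path is read up to time \<open>t\<close>, where adaptedness makes it
  measurable for \<open>Fm t\<close>. This is what later makes the conditional probability
  \<open>g\<close> measurable with respect to \<open>F t\<close>.\<close>

lemma measurable_glue_path:
  assumes t: "0 \<le> t"
  shows "(\<lambda>p. path_glue t (path (fst p)) (snd p)) \<in> measurable (Fm t \<Otimes>\<^sub>M D_measure) D_measure"
proof (rule measurable_path_glue)
  show "path (fst p) \<in> D_space" if "p \<in> space (Fm t \<Otimes>\<^sub>M (D_measure :: (real \<Rightarrow> 'd) measure))" for p
    using that by (auto simp: space_pair_measure intro!: path_D_space)
  fix u :: real assume "0 \<le> u"
  then have "path \<omega> (min u t) = X (min u t) \<omega>" for \<omega>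
    using t by (simp add: path_of_def)
  then show "(\<lambda>p. path (fst p) (min u t)) \<in> borel_measurable (Fm t \<Otimes>\<^sub>M (D_measure :: (real \<Rightarrow> 'd) measure))"
    using measurable_compose[OF measurable_fst X_adapted, of "min u t" t] t \<open>0 \<le> u\<close> by simp
qed (use t in simp_all)

text \<open>A path is the concatenation of its past with its own increments, and these are
  independent of \<open>F t\<close> with law \<open>L\<close>; hence they may be exchanged for a
  fresh copy.\<close>

lemma nn_integral_glue_path:
  assumes t: "0 \<le> t" and h: "h \<in> borel_measurable D_measure"
  shows "(\<integral>\<^sup>+ \<omega>. (\<integral>\<^sup>+ z. h (path_glue t (path \<omega>) z) \<partial>L) \<partial>M) = (\<integral>\<^sup>+ y. h y \<partial>L)"
proof -
  let ?k = "\<lambda>p. h (path_glue t (path (fst p)) (snd p))"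
  have "(\<integral>\<^sup>+ y. h y \<partial>L) = (\<integral>\<^sup>+ \<omega>. h (path \<omega>) \<partial>M)"
    by (rule nn_integral_L[OF h])
  also have "\<dots> = (\<integral>\<^sup>+ \<omega>. ?k (\<omega>, path_incr t (path \<omega>)) \<partial>M)"
    using t by (intro nn_integral_cong) (simp add: path_glue_incr path_D_space)
  also have "\<dots> = (\<integral>\<^sup>+ \<omega>. (\<integral>\<^sup>+ y. ?k (\<omega>, y) \<partial>L) \<partial>M)"
    by (rule nn_integral_Fm_incr[OF t measurable_compose[OF measurable_glue_path[OF t] h]])
  finally show ?thesis by simp
qed

lemma nn_integral_glue_L:
  assumes s: "0 \<le> s" and h: "h \<in> borel_measurable D_measure"
  shows "(\<integral>\<^sup>+ y. (\<integral>\<^sup>+ z. h (path_glue s y z) \<partial>L) \<partial>L) = (\<integral>\<^sup>+ y. h y \<partial>L)"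
proof -
  have glue: "(\<lambda>p. path_glue s (fst p) (snd p)) \<in> measurable (D_measure \<Otimes>\<^sub>M D_measure) (D_measure :: (real \<Rightarrow> 'd) measure)"
    using s by (intro measurable_path_glue_D) auto
  have "(\<lambda>y. \<integral>\<^sup>+ z. h (path_glue s y z) \<partial>L) \<in> borel_measurable D_measure"
    using L.borel_measurable_nn_integral_fst[of "\<lambda>p. h (path_glue s (fst p) (snd p))" D_measure]
      measurable_compose[OF glue h]
    by (simp add: measurable_cong_sets[OF sets_pair_measure_cong[OF refl sets_L] refl])
  then have "(\<integral>\<^sup>+ y. (\<integral>\<^sup>+ z. h (path_glue s y z) \<partial>L) \<partial>L)
      = (\<integral>\<^sup>+ \<omega>. (\<integral>\<^sup>+ z. h (path_glue s (path \<omega>) z) \<partial>L) \<partial>M)"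
    by (rule nn_integral_L)
  also have "\<dots> = (\<integral>\<^sup>+ y. h y \<partial>L)"
    by (rule nn_integral_glue_path[OF s h])
  finally show ?thesis .
qed

end

subsection \<open>Random times\<close>

locale levy_process_time = levy_process M F X
  for M :: "'a measure" and F and X :: "real \<Rightarrow> 'a \<Rightarrow> 'd::euclidean_space" +
  fixes R :: "'a \<Rightarrow> ennreal"
  assumes R: "R \<in> borel_measurable M" and R_fin: "measure M {\<omega> \<in> space M. R \<omega> < \<infinity>} > 0"
begin

section \<open>The conditional probability on the event that the random time is finite\<close>

abbreviation fin :: "'a set" where
  "fin \<equiv> finite_part M R"

abbreviation T :: "'a \<Rightarrow> real" where
  "T \<omega> \<equiv> enn2real (R \<omega>)"

abbreviation P' :: "'a measure" where
  "P' \<equiv> cond_fin M R"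

abbreviation FR :: "'a measure" where
  "FR \<equiv> FR_measure M F R"

abbreviation \<Delta> :: "'a \<Rightarrow> real \<Rightarrow> 'd" where
  "\<Delta> \<equiv> incr_at X R"

lemma fin_sets[measurable]: "fin \<in> sets M"
  unfolding finite_part_def using R by measurable

lemma fin_subset: "fin \<subseteq> space M"
  by (auto simp: finite_part_def)

lemma T_measurable: "T \<in> borel_measurable M"
  using R by measurable

lemma R_eq_T: "\<omega> \<in> fin \<Longrightarrow> R \<omega> = ennreal (T \<omega>)"
  by (simp add: finite_part_def)

lemma emeasure_fin: "emeasure M fin \<noteq> 0" "emeasure M fin \<noteq> \<infinity>"
  using R_fin by (auto simp: emeasure_eq_measure finite_part_def)

lemma space_P'[simp]: "space P' = fin"
  using fin_subset by (auto simp: cond_fin_def space_restrict_space)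

lemma sets_P': "sets P' = sets (restrict_space M fin)"
  by (simp add: cond_fin_def)

lemma sets_P'_iff: "A \<in> sets P' \<longleftrightarrow> A \<in> sets M \<and> A \<subseteq> fin"
  unfolding sets_P' by (subst sets_restrict_space_iff) (use fin_subset in \<open>auto simp: Int_absorb2\<close>)

lemma emeasure_P':
  assumes "A \<in> sets M" "A \<subseteq> fin"
  shows "emeasure P' A = emeasure M A / emeasure M fin"
proof -
  have "A \<in> sets (restrict_space M fin)" "fin \<in> sets (restrict_space M fin)"
    using assms fin_subset by (auto simp: sets_restrict_space_iff)
  then show ?thesis
    using assms by (simp add: cond_fin_def emeasure_restrict_space Int_absorb1)
qed

lemma prob_space_P': "prob_space P'"
proof
  show "emeasure P' (space P') = 1"
    using emeasure_fin by (simp add: emeasure_P' less_top[symmetric])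
qed

sublocale P': prob_space P' by (rule prob_space_P')

lemma measurable_P': "f \<in> measurable M N \<Longrightarrow> f \<in> measurable P' N"
  by (erule measurable_finer[OF measurable_restrict_space1[where \<Omega>=fin]])
    (use fin_subset in \<open>simp_all add: sets_P' space_restrict_space Int_absorb2\<close>)

lemma nn_integral_P':
  assumes f: "f \<in> borel_measurable M"
  shows "(\<integral>\<^sup>+ \<omega>. f \<omega> \<partial>P') = (\<integral>\<^sup>+ \<omega>. f \<omega> * indicator fin \<omega> \<partial>M) / emeasure M fin"
proof -
  have *: "fin \<in> sets (restrict_space M fin)"
    using fin_subset by (auto simp: sets_restrict_space_iff)
  have "(\<integral>\<^sup>+ \<omega>. f \<omega> \<partial>P')
      = (\<integral>\<^sup>+ \<omega>. f \<omega> * indicator fin \<omega> \<partial>restrict_space M fin) / emeasure (restrict_space M fin) fin"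
    unfolding cond_fin_def using * f
    by (intro nn_integral_uniform_measure measurable_restrict_space1)
  also have "(\<integral>\<^sup>+ \<omega>. f \<omega> * indicator fin \<omega> \<partial>restrict_space M fin)
      = (\<integral>\<^sup>+ \<omega>. f \<omega> * indicator fin \<omega> \<partial>M)"
    using fin_subset
    by (subst nn_integral_restrict_space) (auto intro!: nn_integral_cong simp: indicator_def Int_absorb2)
  also have "emeasure (restrict_space M fin) fin = emeasure M fin"
    using fin_subset by (subst emeasure_restrict_space) (auto simp: Int_absorb2)
  finally show ?thesis .
qed

lemma incr_at_eq: "\<Delta> \<omega> = path_incr (T \<omega>) (path \<omega>)"
  by (auto simp: incr_at_def path_incr_def path_of_def fun_eq_iff)

lemma measurable_incr: "\<Delta> \<in> measurable M D_measure"
  using measurable_path_incr[OF measurable_path T_measurable] by (simp flip: incr_at_eq)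

section \<open>The sigma-field of the past of a random time\<close>

lemma measurable_FR_id:
  assumes "space N \<subseteq> fin"
    and Y: "\<And>Y :: real \<Rightarrow> 'a \<Rightarrow> real. adapted M F Y \<Longrightarrow> (\<forall>\<omega>\<in>space M. cadlag (\<lambda>t. Y t \<omega>)) \<Longrightarrow>
      (\<lambda>\<omega>. Y (T \<omega>) \<omega>) \<in> borel_measurable N"
  shows "(\<lambda>\<omega>. \<omega>) \<in> measurable N FR"
proof -
  have sub: "space N \<subseteq> space M" using assms(1) fin_subset by auto
  have graph: "(\<lambda>\<omega>. (T \<omega>, \<omega>)) \<in> measurable N (optional_measure M F)"
    unfolding optional_measure_def
  proof (rule measurable_measure_of)
    fix B assume "B \<in> (\<Union>Y \<in> {Y :: real \<Rightarrow> 'a \<Rightarrow> real. adapted M F Y \<and> (\<forall>\<omega>\<in>space M. cadlag (\<lambda>t. Y t \<omega>))}.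
        gen_sets ({0..} \<times> space M) borel (\<lambda>(t, \<omega>). Y t \<omega>))"
    then obtain Y :: "real \<Rightarrow> 'a \<Rightarrow> real" and C where
      Y': "adapted M F Y" "\<forall>\<omega>\<in>space M. cadlag (\<lambda>t. Y t \<omega>)" and C: "C \<in> sets borel"
      and B: "B = (\<lambda>(t, \<omega>). Y t \<omega>) -` C \<inter> ({0..} \<times> space M)"
      by (auto simp: gen_sets_def)
    have "(\<lambda>\<omega>. (T \<omega>, \<omega>)) -` B \<inter> space N = (\<lambda>\<omega>. Y (T \<omega>) \<omega>) -` C \<inter> space N"
      using sub by (auto simp: B)
    also have "\<dots> \<in> sets N" using Y[OF Y'] C by (rule measurable_sets)
    finally show "(\<lambda>\<omega>. (T \<omega>, \<omega>)) -` B \<inter> space N \<in> sets N" .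
  qed (use sub in \<open>auto simp: gen_sets_def\<close>)
  show ?thesis
    unfolding FR_measure_def
  proof (rule measurable_measure_of)
    fix B assume "B \<in> (\<Union>Z \<in> (borel_measurable (optional_measure M F) :: (real \<times> 'a \<Rightarrow> real) set).
        gen_sets fin borel (\<lambda>\<omega>. Z (T \<omega>, \<omega>)))"
    then obtain Z :: "real \<times> 'a \<Rightarrow> real" and C where Z: "Z \<in> borel_measurable (optional_measure M F)"
      and C: "C \<in> sets borel" and B: "B = (\<lambda>\<omega>. Z (T \<omega>, \<omega>)) -` C \<inter> fin"
      by (auto simp: gen_sets_def)
    have "(\<lambda>\<omega>. \<omega>) -` B \<inter> space N = (\<lambda>\<omega>. Z (T \<omega>, \<omega>)) -` C \<inter> space N"
      using assms(1) by (auto simp: B)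
    also have "\<dots> \<in> sets N" using measurable_compose[OF graph Z] C by (rule measurable_sets)
    finally show "(\<lambda>\<omega>. \<omega>) -` B \<inter> space N \<in> sets N" .
  qed (use assms(1) in \<open>auto simp: gen_sets_def\<close>)
qed

text \<open>The preceding \<open>measurable_FR_id\<close> states that the traces of
  \<open>FR\<close> on \<open>space N\<close> lie in \<open>N\<close>. It holds because the optional
  sigma-field is generated by adapted cadlag processes, so the graph map into it need only be tested
  on those.\<close>

lemma space_FR[simp]: "space FR = fin"
  unfolding FR_measure_def by (rule space_measure_of) (auto simp: gen_sets_def)

lemma adapted_measurable: "adapted M F Y \<Longrightarrow> 0 \<le> t \<Longrightarrow> Y t \<in> borel_measurable M"
  using measurable_Fm_M[of t "Y t" borel] by (simp add: adapted_def)

lemma FR_id: "(\<lambda>\<omega>. \<omega>) \<in> measurable P' FR"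
proof (rule measurable_FR_id)
  fix Y :: "real \<Rightarrow> 'a \<Rightarrow> real" assume "adapted M F Y" "\<forall>\<omega>\<in>space M. cadlag (\<lambda>t. Y t \<omega>)"
  then show "(\<lambda>\<omega>. Y (T \<omega>) \<omega>) \<in> borel_measurable P'"
    by (intro measurable_P' measurable_right_continuous_at_time[OF _ _ T_measurable, where Y=Y])
      (auto intro: adapted_measurable cadlag_right_continuous)
qed simp

lemma FR_sets: "A \<in> sets FR \<Longrightarrow> A \<in> sets P'"
  using measurable_sets[OF FR_id, of A] sets.sets_into_space[of A FR] by (simp add: Int_absorb2)

lemma measurable_FR_value:
  fixes Y :: "real \<Rightarrow> 'a \<Rightarrow> real"
  assumes "adapted M F Y" "\<And>\<omega>. \<omega> \<in> space M \<Longrightarrow> cadlag (\<lambda>t. Y t \<omega>)"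
  shows "(\<lambda>\<omega>. Y (T \<omega>) \<omega>) \<in> borel_measurable FR"
proof (rule measurableI)
  have gen: "gen_sets ({0..} \<times> space M) borel (\<lambda>(t, \<omega>). Y t \<omega>) \<subseteq> sets (optional_measure M F)"
    unfolding optional_measure_def using assms
    by (subst sets_measure_of) (auto simp: gen_sets_def intro!: sigma_sets.Basic)
  have Y: "(\<lambda>(t, \<omega>). Y t \<omega>) \<in> borel_measurable (optional_measure M F)"
  proof (rule measurableI)
    fix C :: "real set" assume "C \<in> sets borel"
    moreover have "space (optional_measure M F) = {0..} \<times> space M"
      unfolding optional_measure_def by (rule space_measure_of) (auto simp: gen_sets_def)
    ultimately show "(\<lambda>(t, \<omega>). Y t \<omega>) -` C \<inter> space (optional_measure M F) \<in> sets (optional_measure M F)"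
      using gen by (auto simp: gen_sets_def)
  qed simp
  fix C :: "real set" assume C: "C \<in> sets borel"
  have "(\<lambda>\<omega>. Y (T \<omega>) \<omega>) -` C \<inter> fin \<in> gen_sets fin borel (\<lambda>\<omega>. (\<lambda>(t, \<omega>). Y t \<omega>) (T \<omega>, \<omega>))"
    using C by (auto simp: gen_sets_def)
  then have "(\<lambda>\<omega>. Y (T \<omega>) \<omega>) -` C \<inter> fin \<in> sigma_sets fin
     (\<Union>Z \<in> (borel_measurable (optional_measure M F) :: (real \<times> 'a \<Rightarrow> real) set).
        gen_sets fin borel (\<lambda>\<omega>. Z (T \<omega>, \<omega>)))"
    using Y by (intro sigma_sets.Basic) blast
  then show "(\<lambda>\<omega>. Y (T \<omega>) \<omega>) -` C \<inter> space FR \<in> sets FR"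
    unfolding space_FR unfolding FR_measure_def by (subst sets_measure_of) (auto simp: gen_sets_def)
qed simp

text \<open>The deterministic process \<open>\<lambda>t \<omega>. t\<close> is adapted and cadlag,
  and its value at \<open>R\<close> is \<open>T\<close>.\<close>

lemma measurable_FR_T: "T \<in> borel_measurable FR"
  using measurable_FR_value[of "\<lambda>t \<omega>. t"]
  by (auto simp: adapted_def cadlag_def intro: tendsto_ident_at)

text \<open>For fixed \<open>u\<close> the process \<open>X\<close> stopped at \<open>u\<close> is
  adapted and cadlag, and evaluating it at \<open>R\<close> gives \<open>X\<close> stopped at
  \<open>R\<close> and read at time \<open>u\<close>. Since \<open>FR\<close> is generated by real
  processes, the argument runs over inner products with basis vectors.\<close>

lemma measurable_FR_stopped:
  assumes "0 \<le> u"
  shows "(\<lambda>\<omega>. X (min u (T \<omega>)) \<omega>) \<in> borel_measurable FR"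
proof (rule borel_measurable_euclidean_space[THEN iffD2], rule ballI)
  fix b :: 'd
  have "adapted M F (\<lambda>t \<omega>. X (min u t) \<omega> \<bullet> b)"
    unfolding adapted_def using assms
    by (auto intro!: borel_measurable_inner X_adapted)
  moreover have "cadlag (\<lambda>t. X (min u t) \<omega> \<bullet> b)" if "\<omega> \<in> space M" for \<omega>
  proof (rule cadlag_compose[where h="\<lambda>x. x \<bullet> b"])
    show "cadlag (\<lambda>t. X (min u t) \<omega>)"
      using levy that assms cadlag_stop[of "\<lambda>t. X t \<omega>" u]
      by (simp add: levy_process_wrt_def min.commute)
  qed (intro continuous_intros)
  ultimately show "(\<lambda>\<omega>. X (min u (T \<omega>)) \<omega> \<bullet> b) \<in> borel_measurable FR"
    by (rule measurable_FR_value)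
qed

lemma measurable_FR_X: "value_at X R \<in> borel_measurable FR"
  unfolding value_at_def[abs_def]
proof (rule borel_measurable_euclidean_space[THEN iffD2], rule ballI)
  fix b :: 'd
  have "adapted M F (\<lambda>t \<omega>. X t \<omega> \<bullet> b)"
    unfolding adapted_def by (auto intro!: borel_measurable_inner X_adapted)
  moreover have "cadlag (\<lambda>t. X t \<omega> \<bullet> b)" if "\<omega> \<in> space M" for \<omega>
    using levy that by (intro cadlag_compose[where h="\<lambda>x. x \<bullet> b"]) (auto simp: levy_process_wrt_def intro!: continuous_intros)
  ultimately show "(\<lambda>\<omega>. X (T \<omega>) \<omega> \<bullet> b) \<in> borel_measurable FR"
    by (rule measurable_FR_value)
qed

section \<open>Independence of the increments as a product formula\<close>

lemma measurable_incr_P': "\<Delta> \<in> measurable P' D_measure"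
  by (rule measurable_P'[OF measurable_incr])

lemma incr_event_sets: "C \<in> sets D_measure \<Longrightarrow> fin \<inter> \<Delta> -` C \<in> sets P'"
  using measurable_sets[OF measurable_incr_P'] by (simp add: Int_commute)

text \<open>The product formula contains both halves of the condition: the choice
  \<open>A = fin\<close> gives the law, and inserting that law back gives independence.\<close>

lemma cond_indep_incr_iff:
  "cond_indep_incr M F X R \<longleftrightarrow>
    (\<forall>A\<in>sets FR. \<forall>C\<in>sets D_measure. emeasure P' (A \<inter> \<Delta> -` C) = emeasure P' A * emeasure L C)"
    (is "_ \<longleftrightarrow> ?rhs")
proof
  assume "cond_indep_incr M F X R"
  then have ind: "P'.indep_set (sets FR) (gen_sets fin D_measure \<Delta>)"
    and law: "distr P' D_measure \<Delta> = L"
    by (auto simp: cond_indep_incr_def)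
  show ?rhs
  proof (intro ballI)
    fix A C assume A: "A \<in> sets FR" and C: "C \<in> sets (D_measure :: (real \<Rightarrow> 'd) measure)"
    have "P'.prob (A \<inter> (\<Delta> -` C \<inter> fin)) = P'.prob A * P'.prob (\<Delta> -` C \<inter> fin)"
      using A C by (intro P'.indep_setD[OF ind]) (auto simp: gen_sets_def)
    moreover have "A \<inter> (\<Delta> -` C \<inter> fin) = A \<inter> \<Delta> -` C"
      using FR_sets[OF A] by (auto simp: sets_P'_iff)
    moreover have "emeasure L C = emeasure P' (\<Delta> -` C \<inter> fin)"
      using C measurable_incr_P' by (simp flip: law add: emeasure_distr)
    ultimately show "emeasure P' (A \<inter> \<Delta> -` C) = emeasure P' A * emeasure L C"
      by (simp add: P'.emeasure_eq_measure ennreal_mult)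
  qed
next
  assume rhs: ?rhs
  have law: "distr P' D_measure \<Delta> = L"
  proof (rule measure_eqI)
    fix C assume "C \<in> sets (distr P' D_measure \<Delta>)"
    then have C: "C \<in> sets D_measure" by simp
    have "emeasure P' (fin \<inter> \<Delta> -` C) = emeasure P' fin * emeasure L C"
      using rhs C sets.top[of FR] by simp
    also have "emeasure P' fin = 1"
      using P'.emeasure_space_1 by simp
    finally show "emeasure (distr P' D_measure \<Delta>) C = emeasure L C"
      using C measurable_incr_P' by (simp add: emeasure_distr Int_commute)
  qed (simp add: sets_L)
  moreover have "P'.indep_set (sets FR) (gen_sets fin D_measure \<Delta>)"
  proof (rule P'.indep_setI)
    show "gen_sets fin D_measure \<Delta> \<subseteq> sets P'"
      using incr_event_sets by (auto simp: gen_sets_def Int_commute)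
    fix A B assume A: "A \<in> sets FR" and "B \<in> gen_sets fin D_measure \<Delta>"
    then obtain C where C: "C \<in> sets D_measure" and B: "B = \<Delta> -` C \<inter> fin"
      by (auto simp: gen_sets_def)
    have "A \<inter> B = A \<inter> \<Delta> -` C"
      using FR_sets[OF A] by (auto simp: sets_P'_iff B)
    moreover have "emeasure L C = emeasure P' B"
      using C measurable_incr_P' by (simp flip: law add: emeasure_distr B)
    ultimately have "emeasure P' (A \<inter> B) = emeasure P' A * emeasure P' B"
      using rhs A C by simp
    then show "P'.prob (A \<inter> B) = P'.prob A * P'.prob B"
      by (simp add: P'.emeasure_eq_measure flip: ennreal_mult)
  qed (use FR_sets in auto)
  ultimately show "cond_indep_incr M F X R" by (simp add: cond_indep_incr_def)
qed

lemma nn_integral_FR_incr: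
  assumes "cond_indep_incr M F X R" and k: "k \<in> borel_measurable (FR \<Otimes>\<^sub>M D_measure)"
  shows "(\<integral>\<^sup>+ \<omega>. k (\<omega>, \<Delta> \<omega>) \<partial>P') = (\<integral>\<^sup>+ \<omega>. (\<integral>\<^sup>+ y. k (\<omega>, y) \<partial>L) \<partial>P')"
proof (rule nn_integral_independent_pair[OF _ _ FR_id measurable_incr_P' sets_L _ k])
  fix A C assume A: "A \<in> sets FR" and C: "C \<in> sets (D_measure :: (real \<Rightarrow> 'd) measure)"
  then show "emeasure P' (A \<inter> space P' \<inter> \<Delta> -` C) = emeasure P' (A \<inter> space P') * emeasure L C"
    using assms(1) FR_sets[OF A] by (simp add: cond_indep_incr_iff sets_P'_iff Int_absorb2)
qed (rule P'.finite_measure_axioms L.sigma_finite_measure_axioms)+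

section \<open>Equivalence of the strong Markov property and independence of the increments\<close>

lemma nn_integral_law_from:
  assumes H: "H \<in> borel_measurable D_measure"
  shows "(\<integral>\<^sup>+ y. H y \<partial>law_from M X x) = (\<integral>\<^sup>+ \<omega>. H (path_translate x (path \<omega>)) \<partial>M)"
proof -
  have "law_from M X x = distr M D_measure (\<lambda>\<omega>. path_translate x (path \<omega>))"
    unfolding law_from_def
    by (intro arg_cong[where f="distr M D_measure"]) (auto simp: fun_eq_iff path_of_def path_translate_def)
  then show ?thesis
    using H by (simp add: nn_integral_distr measurable_path_translate measurable_path)
qed

text \<open>Test functions of the form \<open>?H\<close> subtract the starting value first, so their
  integral under the kernel is the same for every starting point and equals the mass under
  \<open>L\<close>.\<close>

lemma markov_imp_indep:
  assumes "cond_strong_markov M F X R"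
  shows "cond_indep_incr M F X R"
  unfolding cond_indep_incr_iff
proof (intro ballI)
  fix A C assume A: "A \<in> sets FR" and C: "C \<in> sets (D_measure :: (real \<Rightarrow> 'd) measure)"
  let ?H = "\<lambda>y. indicator C (path_incr 0 y) :: ennreal"
  have incr0: "path_incr 0 \<in> measurable D_measure (D_measure :: (real \<Rightarrow> 'd) measure)"
    using measurable_path_incr[OF measurable_ident borel_measurable_const[of 0]] by simp
  have H: "?H \<in> borel_measurable D_measure"
    using incr0 borel_measurable_indicator[OF C] by (rule measurable_compose)
  have W: "(indicator A :: 'a \<Rightarrow> ennreal) \<in> borel_measurable FR"
    using A by (rule borel_measurable_indicator)
  have law: "(\<integral>\<^sup>+ y. ?H y \<partial>law_from M X x) = emeasure L C" for x
  proof -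
    have "(\<integral>\<^sup>+ y. ?H y \<partial>law_from M X x) = (\<integral>\<^sup>+ \<omega>. ?H (path_translate x (path \<omega>)) \<partial>M)"
      by (rule nn_integral_law_from[OF H])
    also have "\<dots> = (\<integral>\<^sup>+ \<omega>. indicator C (path \<omega>) \<partial>M)"
    proof (rule nn_integral_cong_AE)
      \<comment> \<open>Subtracting the value at 0 from the translated path leaves \<open>X\<close>
        minus \<open>X 0\<close>, which is the path of \<open>X\<close> almost surely.\<close>
      have "AE \<omega> in M. X 0 \<omega> = 0" using levy by (simp add: levy_process_wrt_def)
      then show "AE \<omega> in M. ?H (path_translate x (path \<omega>)) = indicator C (path \<omega>)"
      proof eventually_elim
        case (elim \<omega>)
        have "path_incr 0 (path_translate x (path \<omega>)) = path \<omega>"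
          using elim by (auto simp: path_incr_def path_translate_def path_of_def fun_eq_iff)
        then show ?case by simp
      qed
    qed
    also have "\<dots> = (\<integral>\<^sup>+ y. indicator C y \<partial>L)"
      using C by (intro nn_integral_L[symmetric]) simp
    also have "\<dots> = emeasure L C"
      using C by (simp add: sets_L)
    finally show ?thesis .
  qed
  have eq: "path_incr 0 (shift_at X R \<omega>) = \<Delta> \<omega>" for \<omega>
    by (auto simp: path_incr_def shift_at_def incr_at_def fun_eq_iff)
  have "emeasure P' (A \<inter> \<Delta> -` C) = (\<integral>\<^sup>+ \<omega>. indicator (A \<inter> \<Delta> -` C) \<omega> \<partial>P')"
  proof (rule nn_integral_indicator[symmetric])
    have "A \<inter> \<Delta> -` C = A \<inter> (fin \<inter> \<Delta> -` C)"
      using FR_sets[OF A] by (auto simp: sets_P'_iff)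
    then show "A \<inter> \<Delta> -` C \<in> sets P'"
      using FR_sets[OF A] incr_event_sets[OF C] by simp
  qed
  also have "\<dots> = (\<integral>\<^sup>+ \<omega>. ?H (shift_at X R \<omega>) * indicator A \<omega> \<partial>P')"
    unfolding eq by (intro nn_integral_cong) (auto simp: indicator_def)
  also have "\<dots> = (\<integral>\<^sup>+ \<omega>. (\<integral>\<^sup>+ y. ?H y \<partial>law_from M X (value_at X R \<omega>)) * indicator A \<omega> \<partial>P')"
    using bspec[OF bspec[OF assms[unfolded cond_strong_markov_def] H] W] .
  also have "\<dots> = emeasure P' A * emeasure L C"
    unfolding law using FR_sets[OF A] by (simp add: nn_integral_cmult_indicator mult.commute[of _ "emeasure L C"])
  finally show "emeasure P' (A \<inter> \<Delta> -` C) = emeasure P' A * emeasure L C" .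
qed

text \<open>The shifted path is the translate of \<open>\<Delta>\<close> by \<open>X\<close> at
  \<open>R\<close>. That translation vector is measurable for \<open>FR\<close>, so it stays fixed
  while \<open>\<Delta>\<close> is replaced by an independent path of law \<open>L\<close>.\<close>

lemma indep_imp_markov:
  assumes "cond_indep_incr M F X R"
  shows "cond_strong_markov M F X R"
  unfolding cond_strong_markov_def
proof (intro ballI)
  fix H :: "(real \<Rightarrow> 'd) \<Rightarrow> ennreal" and W :: "'a \<Rightarrow> ennreal"
  assume H: "H \<in> borel_measurable D_measure" and W: "W \<in> borel_measurable FR"
  let ?k = "\<lambda>(\<omega>, y). H (path_translate (value_at X R \<omega>) y) * W \<omega>"
  have translate: "(\<lambda>p. path_translate (value_at X R (fst p)) (snd p)) \<in> measurable (FR \<Otimes>\<^sub>M D_measure) D_measure"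
    by (intro measurable_path_translate measurable_compose[OF measurable_fst measurable_FR_X] measurable_snd)
  have k: "?k \<in> borel_measurable (FR \<Otimes>\<^sub>M D_measure)"
    using measurable_compose[OF translate H] measurable_compose[OF measurable_fst W]
    unfolding split_beta by measurable
  have shift: "shift_at X R \<omega> = path_translate (value_at X R \<omega>) (\<Delta> \<omega>)" for \<omega>
    by (auto simp: shift_at_def path_translate_def value_at_def incr_at_def fun_eq_iff)
  have trans1: "(\<lambda>y. path_translate x y) \<in> measurable D_measure D_measure" for x :: 'd
    using measurable_path_translate[OF borel_measurable_const measurable_ident] by simp
  have law: "(\<integral>\<^sup>+ y. H y \<partial>law_from M X x) = (\<integral>\<^sup>+ y. H (path_translate x y) \<partial>L)" for x
  proof -
    have "(\<integral>\<^sup>+ y. H y \<partial>law_from M X x) = (\<integral>\<^sup>+ \<omega>. H (path_translate x (path \<omega>)) \<partial>M)"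
      by (rule nn_integral_law_from[OF H])
    also have "\<dots> = (\<integral>\<^sup>+ y. H (path_translate x y) \<partial>L)"
      by (rule nn_integral_L[OF measurable_compose[OF trans1 H], symmetric])
    finally show ?thesis .
  qed
  have "(\<integral>\<^sup>+ \<omega>. H (shift_at X R \<omega>) * W \<omega> \<partial>P') = (\<integral>\<^sup>+ \<omega>. ?k (\<omega>, \<Delta> \<omega>) \<partial>P')"
    by (simp add: shift)
  also have "\<dots> = (\<integral>\<^sup>+ \<omega>. (\<integral>\<^sup>+ y. ?k (\<omega>, y) \<partial>L) \<partial>P')"
    by (rule nn_integral_FR_incr[OF assms k])
  also have "\<dots> = (\<integral>\<^sup>+ \<omega>. (\<integral>\<^sup>+ y. H y \<partial>law_from M X (value_at X R \<omega>)) * W \<omega> \<partial>P')"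
  proof -
    have "(\<lambda>y. H (path_translate x y)) \<in> borel_measurable L" for x
      using measurable_compose[OF trans1 H] by (simp add: measurable_cong_sets[OF sets_L refl])
    then show ?thesis by (simp add: law nn_integral_multc)
  qed
  finally show "(\<integral>\<^sup>+ \<omega>. H (shift_at X R \<omega>) * W \<omega> \<partial>P')
      = (\<integral>\<^sup>+ \<omega>. (\<integral>\<^sup>+ y. H y \<partial>law_from M X (value_at X R \<omega>)) * W \<omega> \<partial>P')" .
qed

section \<open>Stopping times have independent increments\<close>

lemma FR_before_completed:
  assumes stop: "cond_stopping_compl M F R" and A: "A \<in> sets FR" and q: "0 \<le> q"
  shows "A \<inter> {\<omega> \<in> fin. T \<omega> < q} \<in> completed_sets M (F q)"
proof -
  note F = F_sigma_algebra[OF q] F_subset[OF q]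
  let ?G = "sigma (space M) (completed_sets M (F q))"
  interpret C: sigma_algebra "space M" "completed_sets M (F q)"
    by (rule completed_sets_sigma_algebra[OF F])
  have sets_G: "sets ?G = completed_sets M (F q)" by simp
  have mono: "completed_sets M (F t) \<subseteq> completed_sets M (F q)" if "0 \<le> t" "t \<le> q" for t
    unfolding completed_sets_def
    using filtration that by (intro sigma_sets_mono' Un_mono) (auto simp: filtration_on_def)
  have le: "{\<omega> \<in> fin. T \<omega> \<le> t} \<in> sets ?G" if "0 \<le> t" "t \<le> q" for t
  proof -
    have "{\<omega> \<in> fin. T \<omega> \<le> t} = {\<omega> \<in> space M. R \<omega> \<le> ennreal t}"
      using that(1) by (auto simp: finite_part_def enn2real_leI ennreal_enn2real_if
          le_less_trans[OF _ ennreal_less_top] dest: ennreal_leI)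
        (metis ennreal_enn2real ennreal_leI)
    then show ?thesis
      using stop that mono[OF that] by (auto simp: cond_stopping_compl_def)
  qed
  let ?B = "{\<omega> \<in> fin. T \<omega> < q}"
  have B: "?B \<in> sets ?G"
  proof (cases "q = 0")
    case True
    then have "?B = {}" by (auto simp: not_less)
    then show ?thesis by (simp only: sets.empty_sets)
  next
    case False
    then have q: "0 < q" using q by simp
    \<comment> \<open>The strict inequality is exhausted by closed ones; \<open>max 0\<close> is
      there because the stopping property speaks of nonnegative times.\<close>
    have "?B = (\<Union>n. {\<omega> \<in> fin. T \<omega> \<le> max 0 (q - 1 / real (Suc n))})"
    proof (intro equalityI subsetI)
      fix \<omega> assume \<omega>: "\<omega> \<in> ?B"
      then obtain n where "1 / real (Suc n) < q - T \<omega>"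
        using nat_approx_posE[of "q - T \<omega>"] by auto
      then show "\<omega> \<in> (\<Union>n. {\<omega> \<in> fin. T \<omega> \<le> max 0 (q - 1 / real (Suc n))})"
        using \<omega> by (auto intro!: exI[of _ n] simp: max_def)
    next
      fix \<omega> assume "\<omega> \<in> (\<Union>n. {\<omega> \<in> fin. T \<omega> \<le> max 0 (q - 1 / real (Suc n))})"
      then obtain n where n: "\<omega> \<in> fin" "T \<omega> \<le> max 0 (q - 1 / real (Suc n))" by auto
      have "max 0 (q - 1 / real (Suc n)) < q" using q by simp
      with n(2) have "T \<omega> < q" by (rule le_less_trans)
      then show "\<omega> \<in> ?B" using n(1) by simp
    qed
    also have "\<dots> \<in> sets ?G"
    proof (rule sets.countable_UN, rule image_subsetI)
      fix n show "{\<omega> \<in> fin. T \<omega> \<le> max 0 (q - 1 / real (Suc n))} \<in> sets ?G"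
        using q by (intro le) auto
    qed
    finally show ?thesis .
  qed
  let ?N = "restrict_space ?G ?B"
  have space_N: "space ?N = ?B"
    using fin_subset by (auto simp: space_restrict_space)
  have T_N: "T \<in> borel_measurable ?N"
  proof (rule borel_measurableI_le)
    fix a
    have "{\<omega> \<in> ?B. T \<omega> \<le> a} \<in> sets ?G"
    proof (cases "0 \<le> a \<and> a \<le> q")
      case True
      have "{\<omega> \<in> ?B. T \<omega> \<le> a} = ?B \<inter> {\<omega> \<in> fin. T \<omega> \<le> a}" by auto
      also have "\<dots> \<in> sets ?G"
        using True by (intro sets.Int B le) auto
      finally show ?thesis .
    next
      case False
      then consider "a < 0" | "q < a" by linarith
      then show ?thesis
      proof cases
        case 1
        have "\<not> T \<omega> \<le> a" for \<omega> using 1 enn2real_nonneg[of "R \<omega>"] by linarith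
        then show ?thesis by simp
      next
        case 2
        then have "{\<omega> \<in> ?B. T \<omega> \<le> a} = ?B" by auto
        then show ?thesis using B by simp
      qed
    qed
    then show "{\<omega> \<in> space ?N. T \<omega> \<le> a} \<in> sets ?N"
      unfolding space_N using B fin_subset by (subst sets_restrict_space_iff) auto
  qed
  have "(\<lambda>\<omega>. \<omega>) \<in> measurable ?N FR"
  proof (rule measurable_FR_id)
    show "space ?N \<subseteq> fin" unfolding space_N by auto
    fix Y :: "real \<Rightarrow> 'a \<Rightarrow> real"
    assume Y: "adapted M F Y" "\<forall>\<omega>\<in>space M. cadlag (\<lambda>t. Y t \<omega>)"
    \<comment> \<open>Killing \<open>Y\<close> from time \<open>q\<close> on keeps it right
      continuous and makes every one of its values measurable for the completed \<open>F q\<close>.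
      Since \<open>T < q\<close> strictly on \<open>?B\<close>, the value at \<open>T\<close> is
      unchanged.\<close>
    let ?Y = "\<lambda>t \<omega>. if t < q then Y t \<omega> else 0"
    have "(\<lambda>\<omega>. ?Y (T \<omega>) \<omega>) \<in> borel_measurable ?N"
    proof (rule measurable_right_continuous_at_time[where Y="?Y", OF _ _ T_N])
      fix t :: real assume t: "0 \<le> t"
      show "?Y t \<in> borel_measurable ?N"
      proof (cases "t < q")
        case True
        have "Y t \<in> borel_measurable (Fm t)" using Y t by (simp add: adapted_def)
        then have "Y t \<in> borel_measurable ?G"
          by (rule measurable_finer)
            (use completed_sets_superset[OF F_sigma_algebra F_subset, of t] mono[of t] t True in
              \<open>auto simp: sets_Fm space_measure_of_conv\<close>)
        then show ?thesis using True by (simp add: measurable_restrict_space1)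
      qed simp
      fix \<omega> assume "\<omega> \<in> space ?N"
      then have rc: "continuous (at_right t) (\<lambda>t. Y t \<omega>)"
        using Y t fin_subset unfolding space_N by (intro cadlag_right_continuous) auto
      show "continuous (at_right t) (\<lambda>t. ?Y t \<omega>)"
      proof (cases "t < q")
        case True
        have "eventually (\<lambda>u. Y u \<omega> = ?Y u \<omega>) (at_right t)"
          unfolding eventually_at_right_field using True by (intro exI[of _ q]) auto
        then show ?thesis
          using rc True unfolding continuous_within by (auto elim: Lim_transform_eventually)
      next
        case False
        have "eventually (\<lambda>u. ?Y u \<omega> = 0) (at_right t)"
          using eventually_at_right_less[of t] by eventually_elim (use False in auto)
        then show ?thesis
          using False unfolding continuous_within by (simp add: tendsto_eventually)
      qed
    qed simp
    then show "(\<lambda>\<omega>. Y (T \<omega>) \<omega>) \<in> borel_measurable ?N"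
      by (rule measurable_cong[THEN iffD1, rotated]) (simp add: space_N)
  qed
  from measurable_sets[OF this A] have "A \<inter> ?B \<in> sets ?N"
    by (simp add: space_N)
  then have "A \<inter> ?B \<in> sets ?G"
    using B fin_subset by (subst (asm) sets_restrict_space_iff) auto
  then show ?thesis by simp
qed

text \<open>On the event that the dyadic approximation takes a given value, the simple Markov
  property at that fixed time applies. Summing over the values settles the approximating increments,
  and \<open>distr_D_measure_limit\<close> carries the result to \<open>\<Delta>\<close>.\<close>

lemma stopping_imp_indep:
  assumes stop: "cond_stopping_compl M F R"
  shows "cond_indep_incr M F X R"
  unfolding cond_indep_incr_iff
proof (intro ballI)
  fix A C assume A: "A \<in> sets FR" and C: "C \<in> sets (D_measure :: (real \<Rightarrow> 'd) measure)"
  have AM: "A \<in> sets M" and A_fin: "A \<subseteq> fin"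
    using FR_sets[OF A] by (auto simp: sets_P'_iff)
  let ?Q = "density M (indicator A)"
  let ?Yn = "\<lambda>n \<omega>. path_incr (dyadic_above n (T \<omega>)) (path \<omega>)"
  have T_n: "(\<lambda>\<omega>. dyadic_above n (T \<omega>)) \<in> borel_measurable M" for n
    using T_measurable unfolding dyadic_above_def by measurable
  have Yn: "?Yn n \<in> measurable M D_measure" for n
    by (intro measurable_path_incr measurable_path T_n) (simp add: dyadic_above_def)
  have "distr ?Q D_measure \<Delta> = density L (\<lambda>_. emeasure M A)"
  proof (rule distr_D_measure_limit)
    show "finite_measure ?Q"
      using AM by (rule finite_measure_restricted)
    show "?Yn n \<in> measurable ?Q D_measure" for n using Yn by simp
    show "\<Delta> \<in> measurable ?Q D_measure" using measurable_incr by simp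
  next
    fix \<omega> and t :: real assume \<omega>: "\<omega> \<in> space ?Q" and t: "0 \<le> t"
    have cad: "cadlag (path \<omega>)"
      using \<omega> by (intro cadlag_D_space path_D_space) simp
    \<comment> \<open>Needed for both \<open>u = t\<close> and \<open>u = 0\<close>, because an
      increment involves the endpoint and the starting point.\<close>
    have "(\<lambda>n. path \<omega> (dyadic_above n (T \<omega>) + u)) \<longlonglongrightarrow> path \<omega> (T \<omega> + u)" if "0 \<le> u" for u
    proof -
      have "cadlag (\<lambda>r. path \<omega> (r + u))"
        using cadlag_shift[OF cad that] by (simp add: add.commute)
      then have "((\<lambda>r. path \<omega> (r + u)) \<longlongrightarrow> path \<omega> (T \<omega> + u)) (at_right (T \<omega>))"
        by (auto simp: cadlag_def continuous_within)
      then show ?thesis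
        using dyadic_above_tendsto[OF enn2real_nonneg] by (rule filterlim_compose)
    qed
    from tendsto_diff[OF this[OF t] this[of 0]]
    show "(\<lambda>n. ?Yn n \<omega> t) \<longlonglongrightarrow> \<Delta> \<omega> t"
      using t by (simp add: incr_at_eq path_incr_def)
  next
    fix n
    show "distr ?Q D_measure (?Yn n) = density L (\<lambda>_. emeasure M A)"
    proof (rule measure_eqI)
      fix C assume "C \<in> sets (distr ?Q D_measure (?Yn n))"
      then have C: "C \<in> sets D_measure" by simp
      \<comment> \<open>\<open>?q k\<close> is the value of the approximation on
        \<open>?A k\<close>, the part of \<open>A\<close> where \<open>T\<close> lies in the dyadic
        interval closed at \<open>k / 2 ^ n\<close> and open at \<open>?q k\<close>.\<close>
      let ?q = "\<lambda>k. real (k + 1) / 2 ^ n"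
      let ?A = "\<lambda>k. {\<omega> \<in> A. nat \<lfloor>T \<omega> * 2 ^ n\<rfloor> = k}"
      let ?S = "\<lambda>k. ?A k \<inter> {\<omega> \<in> space M. path_incr (?q k) (path \<omega>) \<in> C}"
      have A_k: "?A k \<in> completed_sets M (F (?q k))" for k
      proof -
        have q0: "0 \<le> ?q k" by simp
        interpret CS: sigma_algebra "space M" "completed_sets M (F (?q k))"
          using F_sigma_algebra[OF q0] F_subset[OF q0] by (rule completed_sets_sigma_algebra)
        have "F (real k / 2 ^ n) \<subseteq> F (?q k)"
          using filtration by (auto simp: filtration_on_def divide_right_mono)
        then have "completed_sets M (F (real k / 2 ^ n)) \<subseteq> completed_sets M (F (?q k))"
          unfolding completed_sets_def by (intro sigma_sets_mono' Un_mono) auto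
        then have "A \<inter> {\<omega> \<in> fin. T \<omega> < real k / 2 ^ n} \<in> completed_sets M (F (?q k))"
          using FR_before_completed[OF stop A, of "real k / 2 ^ n"] by auto
        moreover have "A \<inter> {\<omega> \<in> fin. T \<omega> < ?q k} \<in> completed_sets M (F (?q k))"
          by (rule FR_before_completed[OF stop A q0])
        moreover have "?A k = A \<inter> {\<omega> \<in> fin. T \<omega> < ?q k} - A \<inter> {\<omega> \<in> fin. T \<omega> < real k / 2 ^ n}"
        proof -
          have "nat \<lfloor>T \<omega> * 2 ^ n\<rfloor> = k \<longleftrightarrow> T \<omega> < ?q k \<and> \<not> T \<omega> < real k / 2 ^ n" for \<omega>
          proof -
            have "nat \<lfloor>T \<omega> * 2 ^ n\<rfloor> = k \<longleftrightarrow> \<lfloor>T \<omega> * 2 ^ n\<rfloor> = int k"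
              by (simp add: nat_eq_iff)
            also have "\<dots> \<longleftrightarrow> real k \<le> T \<omega> * 2 ^ n \<and> T \<omega> * 2 ^ n < real (k + 1)"
              by (simp add: floor_eq_iff add.commute)
            also have "\<dots> \<longleftrightarrow> T \<omega> < ?q k \<and> \<not> T \<omega> < real k / 2 ^ n"
              by (simp add: pos_less_divide_eq not_less conj_commute)
            finally show ?thesis .
          qed
          then show ?thesis using A_fin by auto
        qed
        ultimately show ?thesis by (simp only: CS.Diff)
      qed
      have A_k_M: "?A k \<in> sets M" for k
        using A_k completed_sets_subset[OF F_sigma_algebra F_subset, of "?q k"] by auto
      have S_M: "?S k \<in> sets M" for k
      proof -
        have "(\<lambda>\<omega>. path_incr (?q k) (path \<omega>)) \<in> measurable M D_measure"
          by (intro measurable_path_incr measurable_path) auto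
        from sets.Int[OF A_k_M[of k] measurable_sets[OF this C]] show ?thesis
          by (simp only: vimage_def Int_def mem_Collect_eq conj_commute)
      qed
      have "emeasure (distr ?Q D_measure (?Yn n)) C = emeasure M (A \<inter> (?Yn n -` C \<inter> space M))"
        using C AM Yn[of n] measurable_sets[OF Yn C] by (simp add: emeasure_distr emeasure_restricted)
      also have "A \<inter> (?Yn n -` C \<inter> space M) = (\<Union>k. ?S k)"
        by (auto simp: dyadic_above_def)
      also have "emeasure M (\<Union>k. ?S k) = (\<Sum>k. emeasure M (?S k))"
        using S_M by (intro suminf_emeasure[symmetric]) (auto simp: disjoint_family_on_def)
      also have "\<dots> = (\<Sum>k. emeasure M (?A k) * emeasure L C)"
        using simple_markov_completed[OF _ A_k C] by simp
      also have "\<dots> = (\<Sum>k. emeasure M (?A k)) * emeasure L C"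
        by simp
      also have "(\<Sum>k. emeasure M (?A k)) = emeasure M (\<Union>k. ?A k)"
        using A_k_M by (intro suminf_emeasure) (auto simp: disjoint_family_on_def)
      also have "(\<Union>k. ?A k) = A" by auto
      also have "emeasure M A * emeasure L C = emeasure (density L (\<lambda>_. emeasure M A)) C"
        using C by (simp add: emeasure_density_const sets_L)
      finally show "emeasure (distr ?Q D_measure (?Yn n)) C = emeasure (density L (\<lambda>_. emeasure M A)) C" .
    qed (simp add: sets_L)
  qed
  then have "emeasure (distr ?Q D_measure \<Delta>) C = emeasure (density L (\<lambda>_. emeasure M A)) C"
    by simp
  moreover have "A \<inter> (\<Delta> -` C \<inter> space M) = A \<inter> \<Delta> -` C"
    using A_fin fin_subset by auto
  ultimately have eq: "emeasure M (A \<inter> \<Delta> -` C) = emeasure M A * emeasure L C"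
    and S: "A \<inter> \<Delta> -` C \<in> sets M"
    using C AM measurable_incr measurable_sets[OF measurable_incr C] sets.Int[OF AM measurable_sets[OF measurable_incr C]]
    by (simp_all add: emeasure_distr emeasure_restricted emeasure_density_const sets_L)
  \<comment> \<open>Both events lie in \<open>fin\<close>, so dividing the formula for
    \<open>M\<close> by \<open>emeasure M fin\<close> gives the one for \<open>P'\<close>.\<close>
  have "A \<inter> \<Delta> -` C \<subseteq> fin" using A_fin by auto
  then show "emeasure P' (A \<inter> \<Delta> -` C) = emeasure P' A * emeasure L C"
    using S AM A_fin by (simp add: emeasure_P' eq ennreal_times_divide mult.commute)
qed

section \<open>Independent increments force the stopping property\<close>

lemma indep_imp_stopping:
  assumes R_nat: "R \<in> borel_measurable (sigma (space M) (completed_sets M (natural_sets M X)))"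
    and ind: "cond_indep_incr M F X R"
  shows "cond_stopping_compl M F R"
  unfolding cond_stopping_compl_def
proof (intro allI impI)
  fix t :: real assume t: "0 \<le> t"
  let ?S = "{\<omega> \<in> space M. R \<omega> \<le> ennreal t}"
  note nat = natural_sets_sigma_algebra natural_sets_subset
  have S_fin: "?S \<subseteq> fin"
    by (auto simp: finite_part_def intro: le_less_trans[OF _ ennreal_less_top])
  have S_T: "\<omega> \<in> ?S \<longleftrightarrow> T \<omega> \<le> t" if "\<omega> \<in> fin" for \<omega>
  proof -
    have "R \<omega> \<le> ennreal t \<longleftrightarrow> ennreal (T \<omega>) \<le> ennreal t"
      by (simp only: R_eq_T[OF that, symmetric])
    then show ?thesis using t that fin_subset by (auto simp: ennreal_le_iff)
  qed
  have S_M: "?S \<in> sets M" using R by measurable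
  have "?S \<in> completed_sets M (natural_sets M X)"
  proof -
    interpret C: sigma_algebra "space M" "completed_sets M (natural_sets M X)"
      by (rule completed_sets_sigma_algebra[OF nat])
    have "{\<omega> \<in> space (sigma (space M) (completed_sets M (natural_sets M X))). R \<omega> \<le> ennreal t}
        \<in> sets (sigma (space M) (completed_sets M (natural_sets M X)))"
      using R_nat by measurable
    then show ?thesis by (simp add: space_measure_of_conv)
  qed
  \<comment> \<open>The measurability assumption on \<open>R\<close> makes \<open>?S\<close>, up to
    a null set, an event about the path, so that it makes sense to resample part of that
    path.\<close>
  from completed_sets_AE_eq[OF nat this] obtain A where
    "A \<in> natural_sets M X" "AE \<omega> in M. \<omega> \<in> ?S \<longleftrightarrow> \<omega> \<in> A" by blast
  moreover from this(1) obtain B where B: "B \<in> sets D_measure" "A = path -` B \<inter> space M"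
    using natural_sets_path by blast
  ultimately have S_B: "AE \<omega> in M. \<omega> \<in> ?S \<longleftrightarrow> path \<omega> \<in> B"
    using AE_space by auto
  define h where "h = (indicator B :: _ \<Rightarrow> ennreal)"
  have h: "h \<in> borel_measurable D_measure"
    unfolding h_def using B(1) by (rule borel_measurable_indicator)
  define g where "g \<omega> = (\<integral>\<^sup>+ z. h (path_glue t (path \<omega>) z) \<partial>L)" for \<omega>
  have g_F: "g \<in> borel_measurable (Fm t)"
    unfolding g_def
    using L.borel_measurable_nn_integral_fst[of "\<lambda>p. h (path_glue t (path (fst p)) (snd p))" "Fm t"]
      measurable_compose[OF measurable_glue_path[OF t] h]
    by (simp add: measurable_cong_sets[OF sets_pair_measure_cong[OF refl sets_L] refl])
  have g_M[measurable]: "g \<in> borel_measurable M"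
    using t g_F by (rule measurable_Fm_M)
  have g_le: "g \<omega> \<le> 1" for \<omega>
  proof -
    have "g \<omega> \<le> (\<integral>\<^sup>+ z. 1 \<partial>L)"
      unfolding g_def h_def by (intro nn_integral_mono) (simp add: indicator_def)
    then show ?thesis by (simp add: L.emeasure_space_1)
  qed
  have SB_M: "(\<integral>\<^sup>+ \<omega>. h (path \<omega>) \<partial>M) = emeasure M ?S"
  proof -
    have "(\<integral>\<^sup>+ \<omega>. h (path \<omega>) \<partial>M) = (\<integral>\<^sup>+ \<omega>. indicator ?S \<omega> \<partial>M)"
      using S_B by (intro nn_integral_cong_AE) (auto simp: h_def indicator_def)
    then show ?thesis using S_M by simp
  qed
  have g_int: "(\<integral>\<^sup>+ \<omega>. g \<omega> \<partial>M) = emeasure M ?S"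
  proof -
    have "(\<integral>\<^sup>+ \<omega>. g \<omega> \<partial>M) = (\<integral>\<^sup>+ y. h y \<partial>L)"
      unfolding g_def by (rule nn_integral_glue_path[OF t h])
    also have "\<dots> = (\<integral>\<^sup>+ \<omega>. h (path \<omega>) \<partial>M)"
      by (rule nn_integral_L[OF h])
    finally show ?thesis using SB_M by simp
  qed
  \<comment> \<open>Independence at \<open>R\<close> enters here. Both sides are shown to equal the
    same integral, in which all increments after \<open>R\<close> have been resampled.\<close>
  have g_S_P': "(\<integral>\<^sup>+ \<omega>. indicator ?S \<omega> * g \<omega> \<partial>P') = (\<integral>\<^sup>+ \<omega>. indicator ?S \<omega> * h (path \<omega>) \<partial>P')"
  proof -
    \<comment> \<open>On \<open>fin\<close> this is the indicator of \<open>?S\<close>, written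
      through \<open>T\<close> so that it is visibly measurable for \<open>FR\<close>.\<close>
    let ?I = "\<lambda>\<omega>. indicator {\<omega>. T \<omega> \<le> t} \<omega> :: ennreal"
    let ?outer = "\<lambda>\<omega> w. path_glue (T \<omega>) (path \<omega>) w"
    \<comment> \<open>The \<open>max 0\<close> is inactive where \<open>?I\<close> is nonzero;
      elsewhere it keeps the gluing time nonnegative, as joint measurability and
      \<open>nn_integral_glue_L\<close> require.\<close>
    let ?inner = "\<lambda>\<omega> y z. path_glue (max 0 (t - T \<omega>)) y z"
    have I: "?I \<in> borel_measurable FR"
      using measurable_FR_T by measurable
    \<comment> \<open>The source \<open>N\<close> is kept general: the claim is used on two product
      spaces and, with \<open>a\<close> constant, for a single outcome.\<close>
    have outer: "(\<lambda>q. ?outer (a q) (b q)) \<in> measurable N D_measure"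
      if a: "a \<in> measurable N FR" and b: "b \<in> measurable N D_measure" for N :: "'e measure" and a b
    proof (rule measurable_path_glue[OF _ _ b measurable_compose[OF a measurable_FR_T]])
      show "path (a q) \<in> D_space" if "q \<in> space N" for q
        using measurable_space[OF a that] fin_subset by (auto intro!: path_D_space)
      fix u :: real assume u: "0 \<le> u"
      have "path \<omega> (min u (T \<omega>)) = X (min u (T \<omega>)) \<omega>" for \<omega>
        using u by (simp add: path_of_def)
      then show "(\<lambda>q. path (a q) (min u (T (a q)))) \<in> borel_measurable N"
        using measurable_compose[OF a measurable_FR_stopped[OF u]] by simp
    qed simp
    let ?k1 = "\<lambda>p. ?I (fst p) * (\<integral>\<^sup>+ z. h (?outer (fst p) (?inner (fst p) (snd p) z)) \<partial>L)"
    let ?k2 = "\<lambda>p. ?I (fst p) * h (?outer (fst p) (snd p))"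
    have I': "(\<lambda>p. ?I (fst p)) \<in> borel_measurable (FR \<Otimes>\<^sub>M (D_measure :: (real \<Rightarrow> 'd) measure))"
      by (rule measurable_compose[OF measurable_fst I])
    have k2: "?k2 \<in> borel_measurable (FR \<Otimes>\<^sub>M D_measure)"
      using I' measurable_compose[OF outer[OF measurable_fst measurable_snd] h] by measurable
    have k1: "?k1 \<in> borel_measurable (FR \<Otimes>\<^sub>M D_measure)"
    proof -
      let ?N = "(FR \<Otimes>\<^sub>M D_measure) \<Otimes>\<^sub>M (D_measure :: (real \<Rightarrow> 'd) measure)"
      have fst2: "(\<lambda>q. fst (fst q)) \<in> measurable ?N FR"
        by measurable
      have T_N: "(\<lambda>q. max 0 (t - T (fst (fst q)))) \<in> borel_measurable ?N"
        using measurable_compose[OF fst2 measurable_FR_T] by measurable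
      have "(\<lambda>q. ?inner (fst (fst q)) (snd (fst q)) (snd q)) \<in> measurable ?N D_measure"
        by (intro measurable_path_glue_D[OF _ _ T_N]) auto
      from measurable_compose[OF outer[OF fst2 this] h]
      have "(\<lambda>q. h (?outer (fst (fst q)) (?inner (fst (fst q)) (snd (fst q)) (snd q)))) \<in> borel_measurable ?N" .
      then have "(\<lambda>p. \<integral>\<^sup>+ z. h (?outer (fst p) (?inner (fst p) (snd p) z)) \<partial>L)
          \<in> borel_measurable (FR \<Otimes>\<^sub>M D_measure)"
        using L.borel_measurable_nn_integral_fst[of
            "\<lambda>q. h (?outer (fst (fst q)) (?inner (fst (fst q)) (snd (fst q)) (snd q)))" "FR \<Otimes>\<^sub>M D_measure"]
        by (simp add: measurable_cong_sets[OF sets_pair_measure_cong[OF refl sets_L] refl])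
      with I' show ?thesis by measurable
    qed
    have glue: "?outer \<omega> (\<Delta> \<omega>) = path \<omega>" if "\<omega> \<in> fin" for \<omega>
      using that fin_subset by (auto simp: incr_at_eq intro!: path_glue_incr path_D_space)
    have "(\<integral>\<^sup>+ \<omega>. indicator ?S \<omega> * g \<omega> \<partial>P') = (\<integral>\<^sup>+ \<omega>. ?k1 (\<omega>, \<Delta> \<omega>) \<partial>P')"
    proof (rule nn_integral_cong)
      fix \<omega> assume "\<omega> \<in> space P'"
      then have \<omega>: "\<omega> \<in> fin" by simp
      show "indicator ?S \<omega> * g \<omega> = ?k1 (\<omega>, \<Delta> \<omega>)"
      proof (cases "T \<omega> \<le> t")
        case True
        have "path_glue t (path \<omega>) z = ?outer \<omega> (?inner \<omega> (\<Delta> \<omega>) z)" for z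
          using path_glue_assoc[OF enn2real_nonneg True, of "path \<omega>" "\<Delta> \<omega>" z] glue[OF \<omega>] True
          by (simp add: max_def)
        then show ?thesis using True S_T[OF \<omega>] by (simp add: g_def)
      next
        case False
        then show ?thesis using S_T[OF \<omega>] by simp
      qed
    qed
    also have "\<dots> = (\<integral>\<^sup>+ \<omega>. (\<integral>\<^sup>+ y. ?k1 (\<omega>, y) \<partial>L) \<partial>P')"
      by (rule nn_integral_FR_incr[OF ind k1])
    \<comment> \<open>With the outcome fixed, \<open>t - T \<omega>\<close> is a deterministic time,
      so gluing two independent paths of law \<open>L\<close> there again gives a path of law
      \<open>L\<close>. Independence is then used a second time, backwards, to restore
      \<open>\<Delta>\<close>.\<close>
    also have "\<dots> = (\<integral>\<^sup>+ \<omega>. (\<integral>\<^sup>+ y. ?k2 (\<omega>, y) \<partial>L) \<partial>P')"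
    proof (rule nn_integral_cong)
      fix \<omega> assume "\<omega> \<in> space P'"
      then have \<omega>: "\<omega> \<in> fin" by simp
      have "(\<lambda>w. ?outer \<omega> w) \<in> measurable D_measure D_measure"
        using \<omega> by (intro outer[OF measurable_const measurable_ident_sets[OF refl]]) simp
      from measurable_compose[OF this h]
      have "(\<integral>\<^sup>+ y. (\<integral>\<^sup>+ z. h (?outer \<omega> (?inner \<omega> y z)) \<partial>L) \<partial>L) = (\<integral>\<^sup>+ w. h (?outer \<omega> w) \<partial>L)"
        by (intro nn_integral_glue_L) auto
      then show "(\<integral>\<^sup>+ y. ?k1 (\<omega>, y) \<partial>L) = (\<integral>\<^sup>+ y. ?k2 (\<omega>, y) \<partial>L)"
        by (cases "T \<omega> \<le> t") simp_all
    qed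
    also have "\<dots> = (\<integral>\<^sup>+ \<omega>. ?k2 (\<omega>, \<Delta> \<omega>) \<partial>P')"
      by (rule nn_integral_FR_incr[OF ind k2, symmetric])
    also have "\<dots> = (\<integral>\<^sup>+ \<omega>. indicator ?S \<omega> * h (path \<omega>) \<partial>P')"
      using S_T by (intro nn_integral_cong) (auto simp: glue indicator_def)
    finally show ?thesis .
  qed
  have [measurable]: "(\<lambda>\<omega>. h (path \<omega>)) \<in> borel_measurable M"
    using measurable_path h by (rule measurable_compose)
  have S_int: "(\<integral>\<^sup>+ \<omega>. indicator ?S \<omega> * f \<omega> \<partial>P') = (\<integral>\<^sup>+ \<omega>. indicator ?S \<omega> * f \<omega> \<partial>M) / emeasure M fin"
    if f: "f \<in> borel_measurable M" for f
  proof -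
    have "(\<integral>\<^sup>+ \<omega>. indicator ?S \<omega> * f \<omega> \<partial>P')
        = (\<integral>\<^sup>+ \<omega>. indicator ?S \<omega> * f \<omega> * indicator fin \<omega> \<partial>M) / emeasure M fin"
      by (intro nn_integral_P' borel_measurable_times_ennreal borel_measurable_indicator S_M f)
    also have "(\<integral>\<^sup>+ \<omega>. indicator ?S \<omega> * f \<omega> * indicator fin \<omega> \<partial>M) = (\<integral>\<^sup>+ \<omega>. indicator ?S \<omega> * f \<omega> \<partial>M)"
      using S_fin by (intro nn_integral_cong) (auto simp: indicator_def)
    finally show ?thesis .
  qed
  \<comment> \<open>Both integrals over \<open>P'\<close> carry the factor
    \<open>1 / emeasure M fin\<close>, which is positive and finite.\<close>
  have cancel: "a = b" if "a / emeasure M fin = b / emeasure M fin" for a b :: ennreal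
  proof -
    have "x * emeasure M fin / emeasure M fin = x" for x
      using emeasure_fin by (simp add: less_top[symmetric] ennreal_mult_divide_eq)
    then have "emeasure M fin * (x / emeasure M fin) = x" for x
      by (simp add: ennreal_times_divide mult.commute[of "emeasure M fin"])
    from this[of a, unfolded that] this[of b] show ?thesis by (rule trans[OF sym])
  qed
  have "(\<integral>\<^sup>+ \<omega>. indicator ?S \<omega> * g \<omega> \<partial>M) = (\<integral>\<^sup>+ \<omega>. indicator ?S \<omega> * h (path \<omega>) \<partial>M)"
    by (rule cancel) (use g_S_P' in \<open>simp add: S_int\<close>)
  also have "\<dots> = (\<integral>\<^sup>+ \<omega>. indicator ?S \<omega> \<partial>M)"
    using S_B by (intro nn_integral_cong_AE) (auto simp: h_def indicator_def)
  also have "\<dots> = emeasure M ?S" using S_M by simp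
  finally have g_S: "(\<integral>\<^sup>+ \<omega>. indicator ?S \<omega> * g \<omega> \<partial>M) = emeasure M ?S" .
  have [measurable]: "(\<lambda>\<omega>. indicator ?S \<omega> * g \<omega>) \<in> borel_measurable M"
    using S_M by measurable
  have le: "indicator ?S \<omega> * g \<omega> \<le> indicator ?S \<omega>" "indicator ?S \<omega> * g \<omega> \<le> g \<omega>" for \<omega>
    using g_le[of \<omega>] by (auto simp: indicator_def)
  \<comment> \<open>The product lies below both \<open>indicator ?S\<close> and \<open>g\<close>,
    and all three have the integral \<open>emeasure M ?S\<close>. Hence they coincide almost
    everywhere, and \<open>?S\<close> is the event \<open>g = 1\<close> up to a null set.\<close>
  have "AE \<omega> in M. indicator ?S \<omega> * g \<omega> = indicator ?S \<omega>"
    by (rule nn_integral_eq_imp_AE_eq) (use S_M g_S le in simp_all)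
  moreover have "AE \<omega> in M. indicator ?S \<omega> * g \<omega> = g \<omega>"
    by (rule nn_integral_eq_imp_AE_eq) (use g_S g_int le in simp_all)
  ultimately have "AE \<omega> in M. \<omega> \<in> ?S \<longleftrightarrow> \<omega> \<in> {\<omega> \<in> space M. g \<omega> = 1}"
    using AE_space by eventually_elim (auto simp: indicator_def split: if_splits)
  moreover have "{\<omega> \<in> space M. g \<omega> = 1} \<in> F t"
  proof -
    have "g -` {1} \<inter> space (Fm t) \<in> sets (Fm t)"
      using g_F by (rule measurable_sets) simp
    then show ?thesis using t by (simp add: sets_Fm vimage_def Int_def conj_commute)
  qed
  ultimately show "?S \<in> completed_sets M (F t)"
    using S_M completed_setsI_AE[OF F_sigma_algebra[OF t] F_subset[OF t]] by blast
qed

end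

theorem theorem3p20:
  fixes M :: "'a measure"
    and F :: "real \<Rightarrow> 'a set set"
    and X :: "real \<Rightarrow> 'a \<Rightarrow> 'd::euclidean_space"
    and R :: "'a \<Rightarrow> ennreal"
  assumes "prob_space M"
    and "filtration_on M F"
    and "levy_process_wrt M F X"
    and "R \<in> borel_measurable M"
    and "measure M {\<omega> \<in> space M. R \<omega> < \<infinity>} > 0"
  shows "(cond_stopping_compl M F R \<longrightarrow> cond_indep_incr M F X R)
       \<and> (cond_strong_markov M F X R \<longleftrightarrow> cond_indep_incr M F X R)
       \<and> (R \<in> borel_measurable (sigma (space M) (completed_sets M (natural_sets M X)))
            \<longrightarrow> cond_indep_incr M F X R \<longrightarrow> cond_stopping_compl M F R)"
proof -
  interpret prob_space M by fact
  interpret levy_process_time M F X R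
    by unfold_locales fact+
  show ?thesis
    using stopping_imp_indep markov_imp_indep indep_imp_markov indep_imp_stopping by blast
qed

end
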